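(* There exists $\epsilon>0$ such that for every smooth probability measure $\mu$ on $\mathbf{T}$, $$\frac{1+\epsilon}{4}\,\mathcal{W}_2^{2}(\mu,\mu_0)\le E_0(\mu)-E_0(\mu_0),$$ where $E_0$ and $\mu_0$ are the energy and the equilibrium measure for the potential $Q\equiv0$ (so $\mu_0=\alpha$). In other words, for $Q\equiv0$ the transportation inequality $T((1+\epsilon)/4)$ holds for some $\epsilon>0$; thus $T(1/4)$ is not sharp for $Q\equiv 0$.
   Context: $\mathbf{T}$ is the unit circle in $\mathbb{C}$ and $\alpha$ is the normalized (probability) Haar measure on $\mathbf{T}$. A measure on $\mathbf{T}$ is called smooth if it has a smooth density with respect to $\alpha$. For a continuous $Q:\mathbf{T}\to\mathbb{R}$ (a potential) and a probability measure $\mu$ on $\mathbf{T}$, $E_Q(\mu)=\int Q\,d\mu-\iint\log|x-y|\,\mu(dx)\mu(dy)$; $\mu_Q$ denotes the (unique) minimizer of $E_Q$ over probability measures on $\mathbf{T}$. For $\rho>0$, $Q$ satisfies $T(\rho)$ if $\rho\,\mathcal{W}_2^{2}(\mu,\mu_Q)\le E_Q(\mu)-E_Q(\mu_Q)$ for every smooth probability measure $\mu$ on $\mathbf{T}$. Modified Wasserstein distance: let $\exp(x)=e^{ix}$ for $x\in\mathbb{R}$. For a measure $\mu$ on $\mathbf{T}$ let $\bar\mu$ be the measure on $\mathbb{R}$ given by $\bar\mu(A)=\sum_{n\in\mathbb{Z}}\mu(\exp(A\cap[2n\pi,2(n+1)\pi)))$, and let $\bar\mu_u$ be the restriction of $\bar\mu$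 to $[u,u+2\pi)$. For probability measures $\mu,\nu$ on $\mathbf{T}$ and $p\ge1$, $$\mathcal{W}_p(\mu,\nu)=\sup\Big\{W_p(\bar\mu_u,\bar\nu_v): u,v\in[0,2\pi],\ \int x\,\bar\mu_u(dx)=\int x\,\bar\nu_v(dx)\Big\},$$ where $W_p$ is the standard $p$-Wasserstein distance on $\mathbb{R}$ (cost $|x-y|^p$, with the power $1/p$), and the supremum over the empty set is $+\infty$. *)

theory Defs
  imports "HOL-Probability.Probability"
begin

definition circle_borel :: "complex measure" where
  "circle_borel = restrict_space borel (sphere 0 1)"

definition circle_prob :: "complex measure \<Rightarrow> bool" where
  "circle_prob \<mu> \<longleftrightarrow> sets \<mu> = sets circle_borel \<and> prob_space \<mu>"

text \<open>The normalized Haar measure on the circle, as the image of normalized arc length.\<close>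

definition circle_haar :: "complex measure" where
  "circle_haar = distr (uniform_measure lborel {0..<2 * pi}) circle_borel cis"

text \<open>
  Smoothness on the circle is smoothness of the \<open>2\<pi>\<close>-periodic function obtained by
  composing with \<open>cis\<close>, which is a smooth covering map.
\<close>

definition smooth_on_circle :: "(complex \<Rightarrow> real) \<Rightarrow> bool" where
  "smooth_on_circle f \<longleftrightarrow>
     (\<forall>n t. ((deriv ^^ n) (\<lambda>s::real. f (cis s))) differentiable (at t))"

text \<open>Nonnegativity is required because \<open>ennreal\<close> truncates negative values to 0.\<close>

definition smooth_measure :: "complex measure \<Rightarrow> bool" where
  "smooth_measure \<mu> \<longleftrightarrow>
     (\<exists>f. smooth_on_circle f \<and> (\<forall>x\<in>sphere 0 1. 0 \<le> f x) \<and>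
          \<mu> = density circle_haar (\<lambda>x. ennreal (f x)))"

text \<open>The value on the diagonal has to be fixed separately, since \<open>ln 0 = 0\<close> in the library.\<close>

definition log_kernel :: "complex \<Rightarrow> complex \<Rightarrow> ereal" where
  "log_kernel x y = (if x = y then - \<infinity> else ereal (ln (cmod (x - y))))"

text \<open>
  The Bochner integral would return 0 on measures of infinite energy, so positive and negative
  parts are integrated separately. Below it is only applied to functions that are bounded above,
  so the case \<open>\<infinity> - \<infinity>\<close> does not arise.
\<close>

definition ext_integral :: "'a measure \<Rightarrow> ('a \<Rightarrow> ereal) \<Rightarrow> ereal" where
  "ext_integral M f =
     enn2ereal (\<integral>\<^sup>+x. e2ennreal (f x) \<partial>M) - enn2ereal (\<integral>\<^sup>+x. e2ennreal (- f x) \<partial>M)"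

definition log_energy :: "(complex \<Rightarrow> real) \<Rightarrow> complex measure \<Rightarrow> ereal" where
  "log_energy Q \<mu> =
     ereal (\<integral>x. Q x \<partial>\<mu>) - ext_integral (\<mu> \<Otimes>\<^sub>M \<mu>) (\<lambda>(x, y). log_kernel x y)"

definition is_energy_minimizer :: "(complex \<Rightarrow> real) \<Rightarrow> complex measure \<Rightarrow> bool" where
  "is_energy_minimizer Q \<mu> \<longleftrightarrow>
     circle_prob \<mu> \<and> (\<forall>\<nu>. circle_prob \<nu> \<longrightarrow> log_energy Q \<mu> \<le> log_energy Q \<nu>)"

definition equilibrium_measure :: "(complex \<Rightarrow> real) \<Rightarrow> complex measure" where
  "equilibrium_measure Q = (THE \<mu>. is_energy_minimizer Q \<mu>)"

definition ennreal_powr :: "ennreal \<Rightarrow> real \<Rightarrow> ennreal" where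
  "ennreal_powr x p = (if x = \<infinity> then \<infinity> else ennreal (enn2real x powr p))"

definition couplings :: "real measure \<Rightarrow> real measure \<Rightarrow> (real \<times> real) measure set" where
  "couplings \<mu> \<nu> = {\<pi>. sets \<pi> = sets (borel \<Otimes>\<^sub>M borel) \<and>
     distr \<pi> borel fst = \<mu> \<and> distr \<pi> borel snd = \<nu>}"

definition wasserstein :: "real \<Rightarrow> real measure \<Rightarrow> real measure \<Rightarrow> ennreal" where
  "wasserstein p \<mu> \<nu> =
     ennreal_powr (INF \<pi>\<in>couplings \<mu> \<nu>. \<integral>\<^sup>+z. ennreal (\<bar>fst z - snd z\<bar> powr p) \<partial>\<pi>) (1 / p)"

text \<open>
  The set function passed to \<open>measure_of\<close> is countably additive, see \<open>emeasure_circle_lift\<close> below.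
\<close>

definition circle_lift :: "complex measure \<Rightarrow> real measure" where
  "circle_lift \<mu> = measure_of UNIV (sets borel)
     (\<lambda>A. \<Sum>\<^sub>\<infinity>n::int. emeasure \<mu> (cis ` (A \<inter> {2 * of_int n * pi..<2 * (of_int n + 1) * pi})))"

definition circle_lift_at :: "real \<Rightarrow> complex measure \<Rightarrow> real measure" where
  "circle_lift_at u \<mu> = density (circle_lift \<mu>) (indicator {u..<u + 2 * pi})"

text \<open>The supremum of the empty set is \<open>\<infinity>\<close> here, whereas \<open>Sup {} = 0\<close> in \<^typ>\<open>ennreal\<close>.\<close>

definition mod_wasserstein :: "real \<Rightarrow> complex measure \<Rightarrow> complex measure \<Rightarrow> ennreal" where
  "mod_wasserstein p \<mu> \<nu> =
    (let S = {wasserstein p (circle_lift_at u \<mu>) (circle_lift_at v \<nu>) | u v.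
                u \<in> {0..2 * pi} \<and> v \<in> {0..2 * pi} \<and>
                (\<integral>x. x \<partial>circle_lift_at u \<mu>) = (\<integral>x. x \<partial>circle_lift_at v \<nu>)}
     in if S = {} then \<infinity> else Sup S)"

definition transport_inequality :: "real \<Rightarrow> (complex \<Rightarrow> real) \<Rightarrow> bool" where
  "transport_inequality \<rho> Q \<longleftrightarrow>
     (\<forall>\<mu>. circle_prob \<mu> \<and> smooth_measure \<mu> \<longrightarrow>
        ereal \<rho> * enn2ereal ((mod_wasserstein 2 \<mu> (equilibrium_measure Q))\<^sup>2)
          \<le> log_energy Q \<mu> - log_energy Q (equilibrium_measure Q))"

lemma cis_measurable_circle [measurable]: "cis \<in> borel \<rightarrow>\<^sub>M circle_borel"
proof -
  have "cis \<in> borel \<rightarrow>\<^sub>M borel"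
    by (intro borel_measurable_continuous_onI continuous_intros)
  then show ?thesis
    unfolding circle_borel_def by (intro measurable_restrict_space2) auto
qed

lemma circle_prob_haar: "circle_prob circle_haar"
proof -
  have "prob_space (uniform_measure lborel {0..<2 * pi})"
    by (intro prob_space_uniform_measure) auto
  moreover have "cis \<in> uniform_measure lborel {0..<2 * pi} \<rightarrow>\<^sub>M circle_borel"
    by simp
  ultimately show ?thesis
    unfolding circle_prob_def circle_haar_def by (auto intro: prob_space.prob_space_distr)
qed

lemma cis_image_measurable:
  assumes "A \<in> sets borel"
  shows "cis ` (A \<inter> {2 * of_int n * pi..<2 * (of_int n + 1) * pi}) \<in> sets circle_borel"
    (is "cis ` (A \<inter> ?I) \<in> _")
proof -
  define g :: "complex \<Rightarrow> real" where
    "g z = (if 0 \<le> Im z then arccos (max (-1) (min 1 (Re z)))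
            else 2 * pi - arccos (max (-1) (min 1 (Re z)))) + 2 * of_int n * pi" for z
  have "(\<lambda>x::real. arccos (max (-1) (min 1 x))) \<in> borel_measurable borel"
    by (intro borel_measurable_continuous_onI continuous_on_arccos continuous_intros) auto
  then have g: "g \<in> borel_measurable borel"
    unfolding g_def by measurable
  have g_cis: "g (cis x) = x" if "x \<in> ?I" for x
  proof -
    define y where "y = x - 2 * of_int n * pi"
    have y: "0 \<le> y" "y < 2 * pi"
      using that by (auto simp: y_def algebra_simps)
    have x: "x = y + 2 * of_int n * pi"
      by (simp add: y_def)
    have cs: "cos x = cos y" "sin x = sin y"
      using cos_int_2pin[of n] sin_int_2pin[of n]
      by (simp_all add: x cos_add sin_add mult.commute mult.left_commute)
    show ?thesis
    proof (cases "y \<le> pi")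
      case True
      then show ?thesis
        using y sin_ge_zero[of y] by (simp add: g_def cs arccos_cos) (simp add: x)
    next
      case False
      then have "sin y < 0"
        using y by (intro sin_lt_zero) auto
      moreover have "arccos (cos y) = 2 * pi - y"
        using y False arccos_cos[of "2 * pi - y"] by (simp add: cos_diff)
      ultimately show ?thesis
        by (simp add: g_def cs) (simp add: x)
    qed
  qed
  have cis_g: "z \<in> cis ` (A \<inter> ?I)" if z: "cmod z = 1" "g z \<in> A" "g z \<in> ?I" for z
  proof -
    obtain t where t: "0 \<le> t" "t < 2 * pi" "z = cis t"
      using Arg2pi[of z] z(1) by (auto simp: is_Arg_def cis_conv_exp)
    have "z = cis (t + 2 * of_int n * pi)"
      using t cos_int_2pin[of n] sin_int_2pin[of n]
      by (simp add: complex_eq_iff cos_add sin_add mult.commute mult.left_commute)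
    moreover have "t + 2 * of_int n * pi \<in> ?I"
      using t by (auto simp: algebra_simps)
    ultimately show ?thesis
      using g_cis z(2) by auto
  qed
  have "cis ` (A \<inter> ?I) = (g -` (A \<inter> ?I)) \<inter> sphere 0 1"
    using g_cis cis_g by auto
  moreover have "g -` (A \<inter> ?I) \<in> sets borel"
    using measurable_sets[OF g, of "A \<inter> ?I"] assms by auto
  ultimately show ?thesis
    unfolding circle_borel_def by (auto simp: sets_restrict_space)
qed

lemma sets_circle_lift: "sets (circle_lift \<mu>) = sets borel"
  using sets.sigma_sets_eq[of "borel :: real measure"] by (simp add: circle_lift_def)

lemma emeasure_circle_lift:
  assumes "sets \<mu> = sets circle_borel" and "A \<in> sets borel"
  shows "emeasure (circle_lift \<mu>) A =
    (\<Sum>\<^sub>\<infinity>n::int. emeasure \<mu> (cis ` (A \<inter> {2 * of_int n * pi..<2 * (of_int n + 1) * pi})))"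
proof (rule emeasure_measure_of[OF circle_lift_def])
  define F where "F n A = emeasure \<mu> (cis ` (A \<inter> {2 * of_int n * pi..<2 * (of_int n + 1) * pi}))"
    for n :: int and A
  have inj: "x = y" if "cis x = cis y"
    "x \<in> {2 * of_int n * pi..<2 * (of_int n + 1) * pi}"
    "y \<in> {2 * of_int n * pi..<2 * (of_int n + 1) * pi}" for x y and n :: int
  proof -
    have "sin x = sin y \<and> cos x = cos y"
      using that(1) by (simp add: complex_eq_iff)
    then obtain k :: int where k: "x = y + 2 * pi * of_int k"
      using sin_cos_eq_iff by auto
    then have "\<bar>2 * pi * of_int k\<bar> < 2 * pi * 1"
      using that(2,3) by (auto simp: algebra_simps)
    then have "\<bar>of_int k :: real\<bar> < 1"
      by (simp add: abs_mult)
    then have "k = 0"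
      by linarith
    then show ?thesis
      using k by simp
  qed
  have infsum_eq: "(\<Sum>\<^sub>\<infinity>n::int. f n) = (\<integral>\<^sup>+n. f n \<partial>count_space UNIV)" for f :: "int \<Rightarrow> ennreal"
  proof -
    obtain h :: "nat \<Rightarrow> int" where h: "bij h"
      using countableE_infinite[of "UNIV :: int set"]
      by (metis bij_betw_inv_into infinite_UNIV_int countableI_type)
    have "(\<Sum>\<^sub>\<infinity>n::int. f n) = (\<Sum>\<^sub>\<infinity>n. f (h n))"
      using infsum_reindex_bij_betw[OF h, of f] by simp
    also have "\<dots> = (\<Sum>n. f (h n))"
      by (intro sums_unique has_sum_imp_sums has_sum_infsum nonneg_summable_on_complete) auto
    also have "\<dots> = (\<integral>\<^sup>+n. f n \<partial>count_space UNIV)"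
      using nn_integral_bij_count_space[OF h, of f] by (simp add: nn_integral_count_space_nat)
    finally show ?thesis .
  qed
  show "countably_additive (sets (circle_lift \<mu>))
    (\<lambda>A. \<Sum>\<^sub>\<infinity>n::int. emeasure \<mu> (cis ` (A \<inter> {2 * of_int n * pi..<2 * (of_int n + 1) * pi})))"
      proof (rule countably_additiveI, goal_cases)
    case (1 B)
    have B: "B i \<in> sets borel" for i
      using 1(1) by (auto simp: sets_circle_lift)
    have "(\<Sum>i. F n (B i)) = F n (\<Union>i. B i)" for n
    proof -
      let ?I = "{2 * of_int n * pi..<2 * (of_int n + 1) * pi}"
      have "disjoint_family (\<lambda>i. cis ` (B i \<inter> ?I))"
        using 1(2) inj[of _ _ n] unfolding disjoint_family_on_def by blast
      then have "(\<Sum>i. emeasure \<mu> (cis ` (B i \<inter> ?I))) = emeasure \<mu> (\<Union>i. cis ` (B i \<inter> ?I))"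
        using cis_image_measurable[OF B] assms(1) by (intro suminf_emeasure) auto
      also have "(\<Union>i. cis ` (B i \<inter> ?I)) = cis ` ((\<Union>i. B i) \<inter> ?I)"
        by blast
      finally show ?thesis
        by (simp add: F_def)
    qed
    then have "(\<Sum>i. \<Sum>\<^sub>\<infinity>n. F n (B i)) = (\<Sum>\<^sub>\<infinity>n. F n (\<Union>i. B i))"
      by (simp add: infsum_eq flip: nn_integral_suminf)
    then show ?case
      by (simp add: F_def)
  qed
qed (use assms in \<open>auto simp: circle_lift_def positive_def\<close>)

end

theory Submission
  imports Defs "HOL-Real_Asymp.Real_Asymp"
begin

text \<open>
  With \<open>a\<^sub>k = \<integral> z^k d\<mu>\<close>, expanding the logarithm gives \<open>E\<^sub>0(\<mu>) \<ge> \<Sum> |a\<^sub>k|^2 / k\<close>, with both sides zero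
  for the Haar measure. A smooth \<open>\<mu>\<close>, cut open at any point \<open>u\<close>, is transported to the uniform
  measure by its rescaled distribution function. The displacement \<open>H\<close> has derivative \<open>p - 1\<close>, where
  \<open>p\<close> is the density of \<open>\<mu>\<close> relative to Haar measure, so its Fourier coefficients are
  \<open>a\<^sub>k / k\<close> up to phase. Since \<open>\<integral> H^2 p = \<integral> H^2\<close> by periodicity, and equality of the means says exactly that
  \<open>H\<close> has mean zero, Parseval bounds the transport cost by \<open>2 \<Sum> |a\<^sub>k|^2 / k^2 \<le> 2 E\<^sub>0(\<mu>)\<close>.
  Hence \<open>T(1/2)\<close> holds, and \<open>\<epsilon> = 1\<close> works.
\<close>

section \<open>Trigonometric polynomials on the circle\<close>

text \<open>The kernel is -\<infinity> on the diagonal and the energy may be infinite, so the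
  logarithm is never expanded on the circle itself. It is replaced by ln |1 - r z cnj w| with r < 1,
  whose series converges geometrically, and r tends to 1 afterwards. For an arbitrary measure only
  the lower bound on the energy is needed, and a pointwise inequality gives it. The reverse
  inequality is needed for the Haar measure alone, where Fatou's lemma supplies it.

  The equilibrium measure is defined by \<open>THE\<close>, so uniqueness is needed among all
  probability measures on the circle and not just the smooth ones. This is why a measure is
  recovered from its moments.

  On the transport side, series are cut at a finite N: uniform approximation by trigonometric
  polynomials, with arbitrarily small error, takes the place of convergence of Fourier series. The
  modified distance is infinite if no pair of cuts has equal means, so besides bounding every
  admissible cost one such pair must be exhibited.\<close>

lemma space_circle_borel [simp]: "space circle_borel = sphere 0 1"
  by (simp add: circle_borel_def space_restrict_space)

text \<open>\<open>cis\<close> is a covering map, so continuity may be tested in the angle. This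
  makes functions written with the discontinuous \<open>Arg\<close> continuous on the circle as soon
  as they are periodic in the angle.\<close>

lemma continuous_on_sphere_if_cis:
  fixes h :: "complex \<Rightarrow> 'a::topological_space"
  assumes "continuous_on UNIV (\<lambda>t. h (cis t))"
  shows "continuous_on (sphere 0 1) h"
  unfolding continuous_on_eq_continuous_within
proof
  fix z :: complex assume z: "z \<in> sphere 0 1"
  then have z0: "z \<noteq> 0"
    by auto
  then have zz: "cis (Arg z) = z"
    using z cis_Arg[of z] by (simp add: sgn_div_norm)
  \<comment> \<open>A local inverse of \<open>cis\<close> near z: w / z is close to 1, away from the
    branch cut of \<open>Arg\<close>, so this lift is continuous at z even for z = -1.\<close>
  define t where "t w = Arg z + Arg (w / z)" for w
  have eq: "h (cis (t w)) = h w" if "w \<in> sphere 0 1" for w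
  proof -
    have "w / z \<noteq> 0" "cmod (w / z) = 1"
      using that z by (auto simp: norm_divide)
    then have "cis (Arg (w / z)) = w / z"
      by (simp add: cis_Arg sgn_div_norm)
    then have "cis (t w) = w"
      using z0 zz by (simp add: t_def flip: cis_mult)
    then show ?thesis by simp
  qed
  have "continuous (at z within sphere 0 1) (\<lambda>w. w / z)"
    using z0 by (intro continuous_intros)
  then have "continuous (at z within sphere 0 1) (\<lambda>w. Arg (w / z))"
    by (rule continuous_within_compose3[OF continuous_at_Arg, rotated]) (simp add: z0)
  then have "continuous (at z within sphere 0 1) t"
    unfolding t_def by (intro continuous_intros)
  then have t: "(t \<longlongrightarrow> t z) (at z within sphere 0 1)"
    unfolding continuous_within .
  have "isCont (\<lambda>t. h (cis t)) (t z)"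
    using assms unfolding continuous_on_eq_continuous_at[OF open_UNIV] by blast
  from isCont_tendsto_compose[OF this t]
  have "((\<lambda>w. h (cis (t w))) \<longlongrightarrow> h z) (at z within sphere 0 1)"
    unfolding eq[OF z] .
  moreover have "\<forall>\<^sub>F w in at z within sphere 0 1. h (cis (t w)) = h w"
    unfolding eventually_at_filter by (intro always_eventually allI impI eq)
  ultimately show "continuous (at z within sphere 0 1) h"
    unfolding continuous_within by (rule Lim_transform_eventually)
qed

lemma borel_measurable_circle:
  fixes h :: "complex \<Rightarrow> 'a::topological_space"
  assumes "continuous_on (sphere 0 1) h"
  shows "h \<in> borel_measurable circle_borel"
  unfolding circle_borel_def using assms by (rule borel_measurable_continuous_on_restrict)

text \<open>Generated from single frequencies by addition only, so that continuity and equality of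
  integrals are inductions with two short cases. Products and the explicit sum are derived
  below.\<close>

inductive trig_poly :: "(real \<Rightarrow> complex) \<Rightarrow> bool" where
  monom: "trig_poly (\<lambda>t. c * cis (of_int k * t))"
| add: "trig_poly f \<Longrightarrow> trig_poly g \<Longrightarrow> trig_poly (\<lambda>t. f t + g t)"

lemma trig_poly_mult:
  assumes "trig_poly f" "trig_poly g"
  shows "trig_poly (\<lambda>t. f t * g t)"
  using assms(1)
proof induction
  case (monom c k)
  show ?case
    using assms(2)
  proof induction
    case (monom d l)
    have "(\<lambda>t. c * cis (of_int k * t) * (d * cis (of_int l * t))) =
        (\<lambda>t. (c * d) * cis (of_int (k + l) * t))"
      by (auto simp: algebra_simps simp flip: cis_mult)
    then show ?case
      using trig_poly.monom[of "c * d" "k + l"] by simp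
  next
    case (add f g)
    then show ?case
      using trig_poly.add by (simp add: distrib_left)
  qed
next
  case (add f g)
  then show ?case
    using trig_poly.add by (simp add: distrib_right)
qed

lemma trig_poly_real_polynomial:
  assumes "real_polynomial_function g"
  shows "trig_poly (\<lambda>t. complex_of_real (g (cis t)))"
  using assms
proof induction
  case (linear f)
  interpret bounded_linear f by fact
  have f: "f z = Re z * f 1 + Im z * f \<i>" for z
  proof -
    have "z = Re z *\<^sub>R 1 + Im z *\<^sub>R \<i>"
      by (simp add: complex_eq_iff)
    then have "f z = f (Re z *\<^sub>R 1 + Im z *\<^sub>R \<i>)" by simp
    then show ?thesis
      by (simp only: add scaleR) simp
  qed
  \<comment> \<open>Here f (cis t) = f 1 cos t + f \<i> sin t, and the coefficients come from
    writing cos and sin through the frequencies 1 and -1.\<close>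
  have "(\<lambda>t. complex_of_real (f (cis t))) =
      (\<lambda>t. Complex (f 1 / 2) (- f \<i> / 2) * cis (of_int 1 * t)
           + Complex (f 1 / 2) (f \<i> / 2) * cis (of_int (-1) * t))"
    by (rule ext, subst f) (simp add: complex_eq_iff field_simps)
  then show ?case
    by (simp only:) (intro trig_poly.intros)
next
  case (const c)
  show ?case
    using monom[of "of_real c" 0] by simp
next
  case (add f g)
  then show ?case
    using trig_poly.add by simp
next
  case (mult f g)
  then show ?case
    using trig_poly_mult by simp
qed

lemma trig_poly_eq_sum:
  assumes "trig_poly T"
  shows "\<exists>N::nat. \<exists>c. T = (\<lambda>t. \<Sum>k=-int N..int N. c k * cis (of_int k * t))"
  using assms
proof induction
  case (monom c k)
  have "c * cis (of_int k * t) =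
      (\<Sum>j=-int (nat \<bar>k\<bar>)..int (nat \<bar>k\<bar>). (if j = k then c else 0) * cis (of_int j * t))" for t
    by (subst sum.remove[of _ k]) auto
  then show ?case
    by (intro exI[of _ "nat \<bar>k\<bar>"] exI[of _ "\<lambda>j. if j = k then c else 0"] ext)
next
  case (add f g)
  then obtain N c M d where f: "f = (\<lambda>t. \<Sum>k=-int N..int N. c k * cis (of_int k * t))"
    and g: "g = (\<lambda>t. \<Sum>k=-int M..int M. d k * cis (of_int k * t))"
    by blast
  define L where "L = max N M"
  have widen: "(\<Sum>k=-int N..int N. c k * cis (of_int k * t)) =
      (\<Sum>k=-int L..int L. (if \<bar>k\<bar> \<le> int N then c k else 0) * cis (of_int k * t))"
    if "N \<le> L" for N c t
    using that by (intro sum.mono_neutral_cong_left) auto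
  have "(\<lambda>t. f t + g t) = (\<lambda>t. \<Sum>k=-int L..int L. ((if \<bar>k\<bar> \<le> int N then c k else 0) +
      (if \<bar>k\<bar> \<le> int M then d k else 0)) * cis (of_int k * t))"
    unfolding f g by (rule ext, subst (1 2) widen) (auto simp: L_def distrib_right sum.distrib)
  then show ?case
    by (intro exI)
qed

lemma has_vector_derivative_cis_mult:
  "((\<lambda>t. cis (c * t)) has_vector_derivative (\<i> * of_real c * cis (c * x))) (at x within S)"
proof -
  have "((\<lambda>z. exp (\<i> * of_real c * z)) has_field_derivative (\<i> * of_real c * exp (\<i> * of_real c * of_real x)))
      (at (of_real x))"
    by (auto intro!: derivative_eq_intros)
  from has_vector_derivative_real_field[OF this, of S] show ?thesis
    by (simp add: cis_conv_exp mult.assoc)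
qed

lemma integral_cis_period:
  "integral {u..u + 2 * pi} (\<lambda>t. cis (of_int k * t)) = (if k = 0 then 2 * pi else 0)"
proof (cases "k = 0")
  case False
  have "((\<lambda>t. cis (of_int k * t)) has_integral
      (cis (of_int k * (u + 2 * pi)) / (\<i> * of_int k) - cis (of_int k * u) / (\<i> * of_int k))) {u..u + 2 * pi}"
  proof (intro fundamental_theorem_of_calculus)
    fix x
    show "((\<lambda>t. cis (of_int k * t) / (\<i> * of_int k)) has_vector_derivative cis (of_int k * x))
        (at x within {u..u + 2 * pi})"
      using False has_vector_derivative_divide[OF has_vector_derivative_cis_mult[of "of_int k" x], of "\<i> * of_int k"]
      by simp
  qed auto
  moreover have "cis (of_int k * (u + 2 * pi)) = cis (of_int k * u)"
  proof -
    have "cis (of_int k * (u + 2 * pi)) = cis (of_int k * u) * cis (2 * pi * of_int k)"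
      unfolding cis_mult by (simp add: algebra_simps)
    then show ?thesis by simp
  qed
  ultimately show ?thesis
    using False by (auto dest!: integral_unique)
qed (simp add: scaleR_conv_of_real)

section \<open>Measures with a density\<close>

text \<open>Half-open like the window in \<open>circle_lift_at\<close>. The endpoint is a null set,
  so the integrals computed from it run over \<open>{a..b}\<close>.\<close>

abbreviation interval_density :: "(real \<Rightarrow> real) \<Rightarrow> real \<Rightarrow> real \<Rightarrow> real measure" where
  "interval_density q a b \<equiv> density lborel (\<lambda>x. ennreal (q x) * indicator {a..<b} x)"

lemma integral_interval_density:
  fixes g :: "real \<Rightarrow> 'b::euclidean_space"
  assumes q: "continuous_on UNIV q" "\<And>x. 0 \<le> q x" and g: "continuous_on UNIV g"
  shows "integral\<^sup>L (interval_density q a b) g = integral {a..b} (\<lambda>x. q x *\<^sub>R g x)"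
proof -
  have [measurable]: "q \<in> borel_measurable borel" "g \<in> borel_measurable borel"
    using q g by (auto intro: borel_measurable_continuous_onI)
  have "(\<lambda>x. ennreal (q x) * indicator {a..<b} x) = (\<lambda>x. ennreal (q x * indicator {a..<b} x))"
    by (auto simp: indicator_def)
  then have "integral\<^sup>L (interval_density q a b) g =
      (\<integral>x. (q x * indicator {a..<b} x) *\<^sub>R g x \<partial>lborel)"
    using q(2) by (simp only:) (subst integral_density, auto)
  also have "\<dots> = (\<integral>x. indicator {a..b} x *\<^sub>R (q x *\<^sub>R g x) \<partial>lborel)"
  proof (rule integral_cong_AE)
    have "AE x in lborel. x \<noteq> b"
      by (rule AE_lborel_singleton)
    then show "AE x in lborel. (q x * indicator {a..<b} x) *\<^sub>R g x = indicator {a..b} x *\<^sub>R (q x *\<^sub>R g x)"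
      by eventually_elim (auto simp: indicator_def)
  qed auto
  also have "\<dots> = integral {a..b} (\<lambda>x. q x *\<^sub>R g x)"
    unfolding set_lebesgue_integral_def[symmetric]
    by (intro set_borel_integral_eq_integral borel_integrable_atLeastAtMost' continuous_intros
        continuous_on_subset[OF q(1)] continuous_on_subset[OF g]) auto
  finally show ?thesis .
qed

lemma nn_integral_interval_density:
  assumes q: "continuous_on UNIV q" "\<And>x. 0 \<le> q x" and g: "continuous_on UNIV g" "\<And>x. 0 \<le> g x"
  shows "(\<integral>\<^sup>+x. ennreal (g x) \<partial>interval_density q a b) = ennreal (integral {a..b} (\<lambda>x. q x * g x))"
proof -
  have [measurable]: "q \<in> borel_measurable borel" "g \<in> borel_measurable borel"
    using q g by (auto intro: borel_measurable_continuous_onI)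
  have "(\<integral>\<^sup>+x. ennreal (g x) \<partial>interval_density q a b) =
      (\<integral>\<^sup>+x. ennreal (q x) * indicator {a..<b} x * ennreal (g x) \<partial>lborel)"
    by (subst nn_integral_density) auto
  also have "\<dots> = (\<integral>\<^sup>+x. ennreal (q x * g x) * indicator {a..b} x \<partial>lborel)"
  proof (rule nn_integral_cong_AE)
    have "AE x in lborel. x \<noteq> b"
      by (rule AE_lborel_singleton)
    then show "AE x in lborel. ennreal (q x) * indicator {a..<b} x * ennreal (g x) =
        ennreal (q x * g x) * indicator {a..b} x"
      by eventually_elim (auto simp: indicator_def ennreal_mult' q g)
  qed
  also have "\<dots> = ennreal (integral {a..b} (\<lambda>x. q x * g x))"
    by (intro nn_integral_has_integral_lebesgue' integrable_integral integrable_continuous_interval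
       continuous_intros continuous_on_subset[OF q(1)] continuous_on_subset[OF g(1)]) (auto simp: q g)
  finally show ?thesis .
qed

lemma sets_circle_haar [measurable_cong]: "sets circle_haar = sets circle_borel"
  unfolding circle_haar_def by (rule sets_distr)

lemma density_circle_haar_eq_distr:
  assumes f: "continuous_on (sphere 0 1) f" "\<And>x. x \<in> sphere 0 1 \<Longrightarrow> 0 \<le> f x"
  shows "density circle_haar (\<lambda>x. ennreal (f x)) =
    distr (interval_density (\<lambda>t. f (cis t) / (2 * pi)) 0 (2 * pi)) circle_borel cis"
proof -
  have [measurable]: "f \<in> borel_measurable circle_borel"
    using f(1) by (rule borel_measurable_circle)
  have "density circle_haar (\<lambda>x. ennreal (f x)) =
      distr (density (uniform_measure lborel {0..<2 * pi}) (\<lambda>t. ennreal (f (cis t)))) circle_borel cis"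
    unfolding circle_haar_def by (rule density_distr) measurable
  also have "density (uniform_measure lborel {0..<2 * pi}) (\<lambda>t. ennreal (f (cis t))) =
      density lborel (\<lambda>t. indicator {0..<2 * pi} t / emeasure lborel {0..<2 * pi} * ennreal (f (cis t)))"
    unfolding uniform_measure_def by (rule density_density_eq) measurable
  also have "\<dots> = interval_density (\<lambda>t. f (cis t) / (2 * pi)) 0 (2 * pi)"
    by (intro arg_cong[where f = "density lborel"] ext)
       (auto simp: indicator_def divide_ennreal f(2) ennreal_mult'[symmetric] simp flip: ennreal_1)
  finally show ?thesis .
qed

lemma continuous_on_cis_comp:
  assumes "continuous_on (sphere 0 1) g"
  shows "continuous_on UNIV (\<lambda>t. g (cis t))"
proof (rule continuous_on_compose2[OF assms])
  show "continuous_on UNIV cis"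
    by (intro continuous_intros)
qed auto

lemma integral_density_circle_haar:
  fixes g :: "complex \<Rightarrow> 'b::euclidean_space"
  assumes f: "continuous_on (sphere 0 1) f" "\<And>x. x \<in> sphere 0 1 \<Longrightarrow> 0 \<le> f x"
    and g: "continuous_on (sphere 0 1) g"
  shows "integral\<^sup>L (density circle_haar (\<lambda>x. ennreal (f x))) g =
    integral {0..2 * pi} (\<lambda>t. (f (cis t) / (2 * pi)) *\<^sub>R g (cis t))"
proof -
  have "integral\<^sup>L (density circle_haar (\<lambda>x. ennreal (f x))) g =
      (\<integral>t. g (cis t) \<partial>interval_density (\<lambda>t. f (cis t) / (2 * pi)) 0 (2 * pi))"
    by (subst density_circle_haar_eq_distr) (auto intro!: integral_distr borel_measurable_circle f g)
  also have "\<dots> = integral {0..2 * pi} (\<lambda>t. (f (cis t) / (2 * pi)) *\<^sub>R g (cis t))"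
    by (intro integral_interval_density continuous_intros continuous_on_cis_comp f g) (simp_all add: f(2))
  finally show ?thesis .
qed

text \<open>On the circle \<open>cis (of_int k * Arg z)\<close> is the k-th power of z, for k of
  either sign. The jump of \<open>Arg\<close> is a multiple of 2 pi and disappears because k is an
  integer.\<close>

lemma cis_int_Arg_cis: "cis (of_int k * Arg (cis t)) = cis (of_int k * t)"
proof -
  have "cis (Arg (cis t)) = cis t"
    using cis_Arg[of "cis t"] by (simp add: sgn_div_norm)
  then have "cis (Arg (cis t)) powi k = cis t powi k" by simp
  then show ?thesis by (simp add: cis_power_int)
qed

lemma integral_circle_haar_cis_int:
  "(\<integral>z. cis (of_int k * Arg z) \<partial>circle_haar) = (if k = 0 then 1 else 0)" (is "?l = _")
proof -
  have "continuous_on (sphere 0 1) (\<lambda>z. cis (of_int k * Arg z))"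
    by (rule continuous_on_sphere_if_cis) (unfold cis_int_Arg_cis, intro continuous_intros)
  then have "?l = integral {0..2 * pi} (\<lambda>t. (1 / (2 * pi)) *\<^sub>R cis (of_int k * t))"
    using integral_density_circle_haar[of "\<lambda>_. 1" "\<lambda>z. cis (of_int k * Arg z)"]
    unfolding cis_int_Arg_cis by (simp add: density_1)
  also have "\<dots> = (1 / (2 * pi)) *\<^sub>R integral {0..0 + 2 * pi} (\<lambda>t. cis (of_int k * t))"
    by simp
  also have "\<dots> = (if k = 0 then 1 else 0)"
    unfolding integral_cis_period by (simp add: scaleR_conv_of_real)
  finally show ?thesis .
qed

section \<open>Uniqueness from trigonometric moments\<close>

lemma Stone_Weierstrass_trig_poly:
  fixes h :: "complex \<Rightarrow> real"
  assumes "continuous_on (sphere 0 1) h" and "0 < e"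
  obtains g where "trig_poly (\<lambda>t. complex_of_real (g (cis t)))" "continuous_on (sphere 0 1) g"
    "\<And>x. x \<in> sphere 0 1 \<Longrightarrow> \<bar>h x - g x\<bar> < e"
proof -
  obtain g where g: "real_polynomial_function g" "\<And>x. x \<in> sphere 0 1 \<Longrightarrow> \<bar>h x - g x\<bar> < e"
    using Stone_Weierstrass_real_polynomial_function[OF compact_sphere assms] by blast
  moreover have "continuous_on (sphere 0 1) g"
    using g(1) by (intro continuous_on_polymonial_function) (simp add: real_polynomial_function_eq)
  ultimately show ?thesis
    using that trig_poly_real_polynomial by blast
qed

lemma trig_poly_Arg_cis: "trig_poly T \<Longrightarrow> T (Arg (cis t)) = T t"
  by (induction rule: trig_poly.induct) (simp_all add: cis_int_Arg_cis)

lemma continuous_on_trig_poly: "trig_poly T \<Longrightarrow> continuous_on A T"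
  by (induction rule: trig_poly.induct) (intro continuous_intros; assumption)+

lemma continuous_on_trig_poly_Arg: "trig_poly T \<Longrightarrow> continuous_on (sphere 0 1) (\<lambda>z. T (Arg z))"
  by (intro continuous_on_sphere_if_cis) (simp add: trig_poly_Arg_cis continuous_on_trig_poly)

lemma circle_probD:
  assumes "circle_prob \<mu>"
  shows "sets \<mu> = sets circle_borel" "space \<mu> = sphere 0 1" "prob_space \<mu>"
  using assms sets_eq_imp_space_eq[of \<mu> circle_borel] by (auto simp: circle_prob_def)

lemma integrable_continuous_on_circle:
  fixes h :: "complex \<Rightarrow> 'a::{banach, second_countable_topology}"
  assumes "circle_prob \<mu>" "continuous_on (sphere 0 1) h"
  shows "integrable \<mu> h"
proof -
  interpret prob_space \<mu>
    using assms(1) by (rule circle_probD)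
  obtain B where B: "\<And>x. x \<in> sphere 0 1 \<Longrightarrow> norm (h x) \<le> B"
    using compact_imp_bounded[OF compact_continuous_image[OF assms(2) compact_sphere]]
    unfolding bounded_iff by blast
  show ?thesis
  proof (rule integrable_const_bound[where B = B])
    show "AE x in \<mu>. norm (h x) \<le> B"
      using B by (intro AE_I2) (simp only: circle_probD[OF assms(1)])
    show "h \<in> borel_measurable \<mu>"
      using borel_measurable_circle[OF assms(2)]
      by (simp cong: measurable_cong_sets add: circle_probD[OF assms(1)])
  qed
qed

text \<open>By linearity the moments determine the integrals of trigonometric polynomials, which are
  uniformly dense. Both measures have mass 1, so a uniform error e / 2 changes each integral by at
  most e / 2.\<close>

lemma integral_eq_if_trig_moments_eq:
  fixes h :: "complex \<Rightarrow> real"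
  assumes \<mu>: "circle_prob \<mu>" and \<nu>: "circle_prob \<nu>"
    and eq: "\<And>k::int. (\<integral>z. cis (of_int k * Arg z) \<partial>\<mu>) = (\<integral>z. cis (of_int k * Arg z) \<partial>\<nu>)"
    and h: "continuous_on (sphere 0 1) h"
  shows "integral\<^sup>L \<mu> h = integral\<^sup>L \<nu> h"
proof -
  have trig: "(\<integral>z. T (Arg z) \<partial>\<mu>) = (\<integral>z. T (Arg z) \<partial>\<nu>)" if "trig_poly T" for T
    using that
  proof induction
    case (add f g)
    then show ?case
      using \<mu> \<nu> by (simp add: integrable_continuous_on_circle continuous_on_trig_poly_Arg)
  qed (simp add: eq)
  have "\<bar>integral\<^sup>L \<mu> h - integral\<^sup>L \<nu> h\<bar> \<le> e" if "e > 0" for e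
  proof -
    from that have "0 < e / 2" by simp
    from Stone_Weierstrass_trig_poly[OF h this] obtain g where
      g: "trig_poly (\<lambda>t. complex_of_real (g (cis t)))" "continuous_on (sphere 0 1) g"
        "\<And>x. x \<in> sphere 0 1 \<Longrightarrow> \<bar>h x - g x\<bar> < e / 2"
      by blast
    \<comment> \<open>\<open>trig_poly\<close> speaks of functions of the angle; on the circle
      \<open>cis (Arg z) = z\<close> turns them back into functions of z.\<close>
    have eq_g: "complex_of_real (g (cis (Arg z))) = complex_of_real (g z)" if "z \<in> sphere 0 1" for z
      using that cis_Arg[of z] by (cases "z = 0") (simp_all add: sgn_div_norm)
    have bd: "\<bar>integral\<^sup>L \<rho> h - integral\<^sup>L \<rho> g\<bar> \<le> e / 2" if \<rho>: "circle_prob \<rho>" for \<rho>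
    proof -
      interpret prob_space \<rho>
        using \<rho> by (rule circle_probD)
      note int = integrable_continuous_on_circle[OF \<rho> h] integrable_continuous_on_circle[OF \<rho> g(2)]
      have "\<bar>integral\<^sup>L \<rho> h - integral\<^sup>L \<rho> g\<bar> = \<bar>\<integral>x. h x - g x \<partial>\<rho>\<bar>"
        using int by simp
      also have "\<dots> \<le> (\<integral>x. \<bar>h x - g x\<bar> \<partial>\<rho>)"
        by (rule integral_abs_bound)
      also have "\<dots> \<le> (\<integral>x. e / 2 \<partial>\<rho>)"
      proof (rule integral_mono_AE)
        show "AE x in \<rho>. \<bar>h x - g x\<bar> \<le> e / 2"
          using g(3) by (intro AE_I2) (simp add: circle_probD[OF \<rho>] less_imp_le)
      qed (use int in auto)
      also have "\<dots> = e / 2"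
        by (simp add: prob_space)
      finally show ?thesis .
    qed
    have g_int: "complex_of_real (integral\<^sup>L \<rho> g) = (\<integral>z. complex_of_real (g (cis (Arg z))) \<partial>\<rho>)"
      if \<rho>: "circle_prob \<rho>" for \<rho>
    proof -
      have "(\<integral>z. complex_of_real (g (cis (Arg z))) \<partial>\<rho>) = (\<integral>z. complex_of_real (g z) \<partial>\<rho>)"
        using circle_probD(2)[OF \<rho>] by (intro Bochner_Integration.integral_cong refl eq_g) simp
      then show ?thesis
        by simp
    qed
    have "complex_of_real (integral\<^sup>L \<mu> g) = complex_of_real (integral\<^sup>L \<nu> g)"
      using trig[OF g(1)] g_int[OF \<mu>] g_int[OF \<nu>] by simp
    then have "integral\<^sup>L \<mu> g = integral\<^sup>L \<nu> g"
      by (simp only: of_real_eq_iff)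
    then show ?thesis
      using bd[OF \<mu>] bd[OF \<nu>] by linarith
  qed
  from field_le_epsilon[of "\<bar>integral\<^sup>L \<mu> h - integral\<^sup>L \<nu> h\<bar>" 0] this show ?thesis
    by simp
qed

lemma circle_prob_eqI:
  assumes \<mu>: "circle_prob \<mu>" and \<nu>: "circle_prob \<nu>"
    and eq: "\<And>k::int. (\<integral>z. cis (of_int k * Arg z) \<partial>\<mu>) = (\<integral>z. cis (of_int k * Arg z) \<partial>\<nu>)"
  shows "\<mu> = \<nu>"
proof -
  \<comment> \<open>Both measures are pushed forward to the whole plane, where the closed sets are
    an intersection-stable generator of \<open>borel\<close>; the circle is recovered at the
    end.\<close>
  have id: "(\<lambda>x. x) \<in> \<rho> \<rightarrow>\<^sub>M borel" if "circle_prob \<rho>" for \<rho>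
    using borel_measurable_circle[OF continuous_on_id]
    by (simp cong: measurable_cong_sets add: circle_probD[OF that])
  \<comment> \<open>The tent functions are continuous and converge to the indicator of C. The set C
    must be nonempty: \<open>infdist z {}\<close> is 0 by convention, which would make every tent
    equal to 1.\<close>
  have lim: "(\<lambda>n. \<integral>z. max 0 (1 - real n * infdist z C) \<partial>\<rho>) \<longlonglongrightarrow> measure (distr \<rho> borel (\<lambda>x. x)) C"
    if \<rho>: "circle_prob \<rho>" and C: "closed C" "C \<noteq> {}" for \<rho> C
  proof -
    interpret prob_space \<rho>
      using \<rho> by (rule circle_probD)
    note [measurable] = id[OF \<rho>]
    have C' [measurable]: "C \<in> sets borel"
      using C by simp
    have "(\<lambda>n. \<integral>z. max 0 (1 - real n * infdist z C) \<partial>\<rho>) \<longlonglongrightarrow> (\<integral>z. indicator C z \<partial>\<rho>)"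
    proof (rule integral_dominated_convergence[where w = "\<lambda>_. 1"])
      have [measurable]: "(\<lambda>z. infdist z C) \<in> borel_measurable borel"
        by (intro borel_measurable_continuous_onI continuous_intros)
      show "(\<lambda>z. max 0 (1 - real n * infdist z C)) \<in> borel_measurable \<rho>" for n
        by (rule measurable_compose[OF id[OF \<rho>]]) measurable
      show "(indicator C :: complex \<Rightarrow> real) \<in> borel_measurable \<rho>"
        by (rule measurable_compose[OF id[OF \<rho>]]) measurable
      show "AE z in \<rho>. (\<lambda>n. max 0 (1 - real n * infdist z C)) \<longlonglongrightarrow> indicator C z"
      proof (intro AE_I2)
        fix z
        show "(\<lambda>n. max 0 (1 - real n * infdist z C)) \<longlonglongrightarrow> indicator C z"
        proof (cases "z \<in> C")
          case False
          then have "infdist z C > 0"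
            using C infdist_nonneg[of z C] by (metis in_closed_iff_infdist_zero less_eq_real_def)
          then obtain N where N: "1 < real N * infdist z C"
            using reals_Archimedean3 by blast
          have "max 0 (1 - real n * infdist z C) = 0" if "n \<ge> N" for n
          proof -
            have "real N * infdist z C \<le> real n * infdist z C"
              using that by (intro mult_right_mono) (auto simp: infdist_nonneg)
            then show ?thesis
              using N by simp
          qed
          then have "\<forall>\<^sub>F n in sequentially. max 0 (1 - real n * infdist z C) = 0"
            by (auto simp: eventually_sequentially)
          then show ?thesis
            using False by (simp add: tendsto_eventually)
        qed simp
      qed
      show "AE z in \<rho>. norm (max 0 (1 - real n * infdist z C)) \<le> 1" for n
        by (auto simp: infdist_nonneg)
    qed simp
    also have "(\<integral>z. indicator C z \<partial>\<rho>) = measure (distr \<rho> borel (\<lambda>x. x)) C"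
      using sets.sets_into_space by (simp add: measure_distr)
    finally show ?thesis .
  qed
  have "distr \<mu> borel (\<lambda>x. x) = distr \<nu> borel (\<lambda>x. x)"
  proof (rule measure_eqI_generator_eq[where E = "Collect closed" and \<Omega> = UNIV and A = "\<lambda>_. UNIV"])
    interpret M: prob_space "distr \<mu> borel (\<lambda>x. x)"
      using circle_probD(3)[OF \<mu>] id[OF \<mu>] by (rule prob_space.prob_space_distr)
    interpret N: prob_space "distr \<nu> borel (\<lambda>x. x)"
      using circle_probD(3)[OF \<nu>] id[OF \<nu>] by (rule prob_space.prob_space_distr)
    show "emeasure (distr \<mu> borel (\<lambda>x. x)) UNIV \<noteq> \<infinity>"
      using M.emeasure_finite by simp
    show "emeasure (distr \<mu> borel (\<lambda>x. x)) C = emeasure (distr \<nu> borel (\<lambda>x. x)) C"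
      if "C \<in> Collect closed" for C
    proof (cases "C = {}")
      case False
      have "(\<integral>z. max 0 (1 - real n * infdist z C) \<partial>\<mu>) = (\<integral>z. max 0 (1 - real n * infdist z C) \<partial>\<nu>)" for n
        by (intro integral_eq_if_trig_moments_eq[OF \<mu> \<nu> eq] continuous_intros)
      then have "measure (distr \<mu> borel (\<lambda>x. x)) C = measure (distr \<nu> borel (\<lambda>x. x)) C"
        using lim[OF \<mu>, of C] lim[OF \<nu>, of C] that False by (auto intro: LIMSEQ_unique)
      then show ?thesis
        by (simp add: M.emeasure_eq_measure N.emeasure_eq_measure)
    qed simp
  qed (auto simp: Int_stable_def borel_eq_closed)
  then have "emeasure (distr \<mu> borel (\<lambda>x. x)) A = emeasure (distr \<nu> borel (\<lambda>x. x)) A" for A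
    by simp
  moreover have "emeasure (distr \<rho> borel (\<lambda>x. x)) A = emeasure \<rho> A"
    if \<rho>: "circle_prob \<rho>" and A: "A \<in> sets circle_borel" for \<rho> A
  proof -
    have "A \<in> sets borel" "A \<subseteq> sphere 0 1"
      using A by (auto simp: circle_borel_def sets_restrict_space)
    then show ?thesis
      using id[OF \<rho>] by (simp add: emeasure_distr circle_probD[OF \<rho>] Int_absorb2)
  qed
  ultimately have "emeasure \<mu> A = emeasure \<nu> A" if "A \<in> sets circle_borel" for A
    using \<mu> \<nu> that by metis
  then show ?thesis
    using \<mu> \<nu> by (intro measure_eqI) (simp_all add: circle_probD)
qed

section \<open>The logarithmic energy\<close>

text \<open>Passing from f to g enlarges the positive part and shrinks the negative part. Both parts
  of g have finite integral, so the resulting difference is an honest real number even where f is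
  -\<infinity>.\<close>

lemma ext_integral_le_integral:
  assumes g: "integrable M g" and le: "\<And>x. x \<in> space M \<Longrightarrow> f x \<le> ereal (g x)"
  shows "ext_integral M f \<le> ereal (integral\<^sup>L M g)"
proof -
  have fin: "(\<integral>\<^sup>+x. ennreal (g x) \<partial>M) < \<infinity>" "(\<integral>\<^sup>+x. ennreal (- g x) \<partial>M) < \<infinity>"
    using g integrable_minus[OF g] by (auto simp: real_integrable_def less_top)
  have "(\<integral>\<^sup>+x. e2ennreal (f x) \<partial>M) \<le> (\<integral>\<^sup>+x. ennreal (g x) \<partial>M)"
  proof (rule nn_integral_mono)
    show "e2ennreal (f x) \<le> ennreal (g x)" if "x \<in> space M" for x
      using e2ennreal_mono[OF le[OF that]] by simp
  qed
  moreover have "(\<integral>\<^sup>+x. ennreal (- g x) \<partial>M) \<le> (\<integral>\<^sup>+x. e2ennreal (- f x) \<partial>M)"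
  proof (rule nn_integral_mono)
    show "ennreal (- g x) \<le> e2ennreal (- f x)" if "x \<in> space M" for x
    proof -
      have "ereal (- g x) \<le> - f x"
        using le[OF that] by (metis ereal_minus_le_minus uminus_ereal.simps(1))
      from e2ennreal_mono[OF this] show ?thesis
        by simp
    qed
  qed
  ultimately have "ext_integral M f \<le>
      enn2ereal (\<integral>\<^sup>+x. ennreal (g x) \<partial>M) - enn2ereal (\<integral>\<^sup>+x. ennreal (- g x) \<partial>M)"
    unfolding ext_integral_def by (intro ereal_minus_mono) (simp_all flip: less_eq_ennreal.rep_eq)
  also have "\<dots> = ereal (integral\<^sup>L M g)"
  proof -
    have e: "enn2ereal x = ereal (enn2real x)" if "x < \<infinity>" for x
      using that by (cases x) auto
    show ?thesis
      using g fin by (simp add: real_lebesgue_integral_def e)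
  qed
  finally show ?thesis .
qed

section \<open>Moments and the regularised kernel\<close>

definition moment :: "complex measure \<Rightarrow> nat \<Rightarrow> complex" where
  "moment \<mu> k = (\<integral>z. z ^ k \<partial>\<mu>)"

text \<open>The Abel regularisation of the logarithmic kernel: for r = 1 and distinct points of the
  circle it equals ln |z - w|, since |w| = 1.\<close>

definition reg_kernel :: "real \<Rightarrow> complex \<Rightarrow> complex \<Rightarrow> real" where
  "reg_kernel r z w = ln (cmod (1 - of_real r * (z * cnj w)))"

text \<open>Real part of the power series of ln (1 - x) at x = r z cnj w. The term n = 0 contributes
  nothing because division by zero yields 0.\<close>

lemma reg_kernel_sums:
  assumes "cmod z = 1" "cmod w = 1" "0 \<le> r" "r < 1"
  shows "(\<lambda>n. - (r ^ n * Re ((z * cnj w) ^ n) / real n)) sums reg_kernel r z w"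
proof -
  define x where "x = of_real r * (z * cnj w)"
  have x: "cmod x < 1"
    using assms by (simp add: x_def norm_mult)
  then have "1 - x \<noteq> 0"
    by auto
  have "(\<lambda>n. - (x ^ n) / of_nat n) sums ln (1 - x)"
    using Ln_series'[of "- x"] x by simp
  then have "(\<lambda>n. Re (- (x ^ n) / of_nat n)) sums Re (ln (1 - x))"
    by (rule sums_Re)
  moreover have "Re (ln (1 - x)) = reg_kernel r z w"
    using \<open>1 - x \<noteq> 0\<close> by (simp add: reg_kernel_def x_def)
  moreover have "Re (- (x ^ n) / of_nat n) = - (r ^ n * Re ((z * cnj w) ^ n) / real n)" for n
  proof -
    have "x ^ n = of_real (r ^ n) * (z * cnj w) ^ n"
      unfolding x_def power_mult_distrib of_real_power ..
    then show ?thesis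
      by (simp only: Re_divide_of_nat uminus_complex.sel Re_complex_of_real Im_complex_of_real
          times_complex.sel mult_zero_left diff_zero minus_divide_left)
  qed
  ultimately show ?thesis
    by (simp only:)
qed

text \<open>
  This pointwise bound also holds on the diagonal, so no integrability of the kernel
  is needed to pass to \<open>r \<rightarrow> 1\<close>.
\<close>

lemma log_kernel_le_reg_kernel:
  assumes z: "cmod z = 1" and w: "cmod w = 1" and r: "0 < r" "r < 1"
  shows "log_kernel z w \<le> ereal (reg_kernel r z w - ln r / 2)"
proof (cases "z = w")
  case False
  have zw: "(Re z)\<^sup>2 + (Im z)\<^sup>2 = 1" "(Re w)\<^sup>2 + (Im w)\<^sup>2 = 1"
    using z w by (simp_all add: cmod_def)
  define c where "c = Re z * Re w + Im z * Im w"
  have n: "(cmod (z * cnj w))\<^sup>2 = 1"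
    using z w by (simp add: norm_mult)
  have 1: "(cmod (z - w))\<^sup>2 = 2 - 2 * c"
    using zw unfolding cmod_power2 c_def by (simp add: power2_eq_square algebra_simps)
  have 2: "(cmod (1 - of_real r * (z * cnj w)))\<^sup>2 = 1 - 2 * r * c + r\<^sup>2 * (cmod (z * cnj w))\<^sup>2"
    unfolding cmod_power2 c_def by (simp add: power2_eq_square algebra_simps)
  \<comment> \<open>Dropping (1 - r)^2 from this identity leaves the factor sqrt r in front of |z -
    w|, whose logarithm is the correction ln r / 2.\<close>
  have "(cmod (1 - of_real r * (z * cnj w)))\<^sup>2 = r * (cmod (z - w))\<^sup>2 + (1 - r)\<^sup>2"
    unfolding 1 2 n by (simp add: power2_eq_square algebra_simps)
  then have "(sqrt r * cmod (z - w))\<^sup>2 \<le> (cmod (1 - of_real r * (z * cnj w)))\<^sup>2"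
    using r by (simp add: power_mult_distrib)
  then have le: "sqrt r * cmod (z - w) \<le> cmod (1 - of_real r * (z * cnj w))"
    by (rule power2_le_imp_le) simp
  have "0 < sqrt r * cmod (z - w)"
    using r False by simp
  then have "ln (sqrt r * cmod (z - w)) \<le> reg_kernel r z w"
    using le unfolding reg_kernel_def by (subst ln_le_cancel_iff) auto
  then have "ln r / 2 + ln (cmod (z - w)) \<le> reg_kernel r z w"
    using r False by (simp add: ln_mult ln_sqrt)
  then show ?thesis
    using False by (simp add: log_kernel_def)
qed (simp add: log_kernel_def)

lemma prob_space_circle_pair: "circle_prob \<mu> \<Longrightarrow> prob_space (\<mu> \<Otimes>\<^sub>M \<mu>)"
  by (intro prob_space_pair circle_probD)

lemma space_circle_pair: "circle_prob \<mu> \<Longrightarrow> space (\<mu> \<Otimes>\<^sub>M \<mu>) = sphere 0 1 \<times> sphere 0 1"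
  by (simp add: space_pair_measure circle_probD)

lemma measurable_circle_pair:
  assumes "circle_prob \<mu>" and h: "h \<in> borel \<Otimes>\<^sub>M borel \<rightarrow>\<^sub>M N"
  shows "h \<in> \<mu> \<Otimes>\<^sub>M \<mu> \<rightarrow>\<^sub>M N"
proof -
  have [measurable]: "(\<lambda>x. x) \<in> \<mu> \<rightarrow>\<^sub>M borel"
    using borel_measurable_circle[OF continuous_on_id]
    by (simp cong: measurable_cong_sets add: circle_probD[OF assms(1)])
  have "(\<lambda>p. (fst p, snd p)) \<in> \<mu> \<Otimes>\<^sub>M \<mu> \<rightarrow>\<^sub>M borel \<Otimes>\<^sub>M borel"
    by (intro measurable_Pair measurable_compose[OF measurable_fst, of "\<lambda>x. x"]
        measurable_compose[OF measurable_snd, of "\<lambda>x. x"]) measurable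
  from measurable_compose[OF this h] show ?thesis by simp
qed

lemma integral_moment_pair:
  assumes \<mu>: "circle_prob \<mu>"
  shows "integrable (\<mu> \<Otimes>\<^sub>M \<mu>) (\<lambda>(z, w). (z * cnj w) ^ n)"
    and "(\<integral>(z, w). (z * cnj w) ^ n \<partial>(\<mu> \<Otimes>\<^sub>M \<mu>)) = of_real ((cmod (moment \<mu> n))\<^sup>2)"
proof -
  interpret prob_space \<mu>
    using \<mu> by (rule circle_probD)
  interpret P: pair_prob_space \<mu> \<mu> ..
  show int: "integrable (\<mu> \<Otimes>\<^sub>M \<mu>) (\<lambda>(z, w). (z * cnj w) ^ n)"
  proof (rule P.integrable_const_bound[where B = 1])
    show "AE x in \<mu> \<Otimes>\<^sub>M \<mu>. norm (case x of (z, w) \<Rightarrow> (z * cnj w) ^ n) \<le> 1"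
      by (intro AE_I2) (auto simp: space_circle_pair[OF \<mu>] norm_mult norm_power)
    show "(\<lambda>(z, w). (z * cnj w) ^ n) \<in> borel_measurable (\<mu> \<Otimes>\<^sub>M \<mu>)"
      unfolding case_prod_unfold
      by (rule measurable_circle_pair[OF \<mu>], unfold borel_prod)
        (intro borel_measurable_continuous_onI continuous_intros)
  qed
  have "(\<integral>(z, w). (z * cnj w) ^ n \<partial>(\<mu> \<Otimes>\<^sub>M \<mu>)) = (\<integral>z. (\<integral>w. z ^ n * cnj (w ^ n) \<partial>\<mu>) \<partial>\<mu>)"
    using P.integral_fst[OF int] by (simp add: power_mult_distrib)
  also have "\<dots> = (\<integral>z. z ^ n * cnj (moment \<mu> n) \<partial>\<mu>)"
    by (simp add: moment_def flip: complex_cnj_power)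
  also have "\<dots> = moment \<mu> n * cnj (moment \<mu> n)"
    unfolding integral_mult_left_zero moment_def ..
  also have "\<dots> = of_real ((cmod (moment \<mu> n))\<^sup>2)"
    by (rule complex_norm_square[symmetric])
  finally show "(\<integral>(z, w). (z * cnj w) ^ n \<partial>(\<mu> \<Otimes>\<^sub>M \<mu>)) = of_real ((cmod (moment \<mu> n))\<^sup>2)" .
qed

text \<open>Termwise integration: the n-th term is at most r^n in absolute value, so the geometric
  series dominates, and Fubini turns each term into a squared moment.\<close>

lemma integral_reg_kernel:
  assumes \<mu>: "circle_prob \<mu>" and r: "0 < r" "r < 1"
  shows "integrable (\<mu> \<Otimes>\<^sub>M \<mu>) (\<lambda>(z, w). reg_kernel r z w)"
    and "(\<lambda>n. - (r ^ n * (cmod (moment \<mu> n))\<^sup>2 / real n)) sums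
      (\<integral>(z, w). reg_kernel r z w \<partial>(\<mu> \<Otimes>\<^sub>M \<mu>))"
proof -
  interpret P: prob_space "\<mu> \<Otimes>\<^sub>M \<mu>"
    using \<mu> by (rule prob_space_circle_pair)
  define f where "f n p = - (r ^ n * Re ((fst p * cnj (snd p)) ^ n) / real n)" for n p
  have int: "integrable (\<mu> \<Otimes>\<^sub>M \<mu>) (f n)" for n
    unfolding f_def using integrable_Re[OF integral_moment_pair(1)[OF \<mu>, of n]]
    by (intro integrable_minus integrable_divide integrable_mult_right) (simp add: case_prod_unfold)
  have int_f: "integral\<^sup>L (\<mu> \<Otimes>\<^sub>M \<mu>) (f n) = - (r ^ n * (cmod (moment \<mu> n))\<^sup>2 / real n)" for n
  proof -
    have "(\<integral>p. Re ((fst p * cnj (snd p)) ^ n) \<partial>(\<mu> \<Otimes>\<^sub>M \<mu>)) = (cmod (moment \<mu> n))\<^sup>2"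
      using integral_moment_pair[OF \<mu>, of n] by (simp add: case_prod_unfold)
    then show ?thesis
      unfolding f_def by simp
  qed
  have bound: "norm (f n p) \<le> r ^ n" if "p \<in> sphere 0 1 \<times> sphere 0 1" for n p
  proof (cases "n = 0")
    case False
    have "\<bar>Re ((fst p * cnj (snd p)) ^ n)\<bar> \<le> 1"
      using that abs_Re_le_cmod[of "(fst p * cnj (snd p)) ^ n"] by (auto simp: norm_power norm_mult)
    then have "r ^ n * \<bar>Re ((fst p * cnj (snd p)) ^ n)\<bar> \<le> r ^ n * 1"
      using r by (intro mult_left_mono) auto
    also have "\<dots> \<le> r ^ n * real n"
      using r False by (intro mult_left_mono) auto
    finally show ?thesis
      using r False by (simp add: f_def abs_mult divide_le_eq)
  qed (simp add: f_def)
  have geom: "summable (\<lambda>n. r ^ n)"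
    using r by simp
  have 1: "AE p in \<mu> \<Otimes>\<^sub>M \<mu>. summable (\<lambda>n. norm (f n p))"
  proof (intro AE_I2)
    fix p assume "p \<in> space (\<mu> \<Otimes>\<^sub>M \<mu>)"
    then show "summable (\<lambda>n. norm (f n p))"
      using bound by (intro summable_comparison_test'[OF geom, of 0]) (simp add: space_circle_pair[OF \<mu>])
  qed
  have 2: "summable (\<lambda>n. \<integral>p. norm (f n p) \<partial>(\<mu> \<Otimes>\<^sub>M \<mu>))"
  proof (rule summable_comparison_test'[OF geom, of 0])
    fix n
    have "(\<integral>p. norm (f n p) \<partial>(\<mu> \<Otimes>\<^sub>M \<mu>)) \<le> (\<integral>p. r ^ n \<partial>(\<mu> \<Otimes>\<^sub>M \<mu>))"
      using bound int by (intro integral_mono integrable_norm) (auto simp: space_circle_pair[OF \<mu>])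
    then show "norm (\<integral>p. norm (f n p) \<partial>(\<mu> \<Otimes>\<^sub>M \<mu>)) \<le> r ^ n"
      by (simp add: P.prob_space)
  qed
  have eq: "(case p of (z, w) \<Rightarrow> reg_kernel r z w) = (\<Sum>n. f n p)" if "p \<in> space (\<mu> \<Otimes>\<^sub>M \<mu>)" for p
    using reg_kernel_sums[of "fst p" "snd p" r] that r
    by (auto simp: f_def space_circle_pair[OF \<mu>] sums_iff)
  show "integrable (\<mu> \<Otimes>\<^sub>M \<mu>) (\<lambda>(z, w). reg_kernel r z w)"
    using integrable_suminf[OF int 1 2] by (subst Bochner_Integration.integrable_cong[OF refl eq])
  have "(\<integral>(z, w). reg_kernel r z w \<partial>(\<mu> \<Otimes>\<^sub>M \<mu>)) = (\<integral>p. (\<Sum>n. f n p) \<partial>(\<mu> \<Otimes>\<^sub>M \<mu>))"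
    by (rule Bochner_Integration.integral_cong[OF refl eq])
  then show "(\<lambda>n. - (r ^ n * (cmod (moment \<mu> n))\<^sup>2 / real n)) sums
      (\<integral>(z, w). reg_kernel r z w \<partial>(\<mu> \<Otimes>\<^sub>M \<mu>))"
    using sums_integral[OF int 1 2] by (simp add: int_f)
qed

text \<open>The series is truncated at N before r tends to 1. What remains is a finite sum,
  continuous at r = 1, where the correction ln r / 2 also vanishes; no limit is exchanged with an
  infinite sum.\<close>

lemma log_energy_ge_moments:
  assumes \<mu>: "circle_prob \<mu>"
  shows "ereal (\<Sum>k=1..N. (cmod (moment \<mu> k))\<^sup>2 / real k) \<le> log_energy (\<lambda>_. 0) \<mu>"
proof -
  interpret P: prob_space "\<mu> \<Otimes>\<^sub>M \<mu>"
    using \<mu> by (rule prob_space_circle_pair)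
  define \<phi> where "\<phi> r = - (\<Sum>k=1..N. r ^ k * (cmod (moment \<mu> k))\<^sup>2 / real k) - ln r / 2" for r
  let ?E = "ext_integral (\<mu> \<Otimes>\<^sub>M \<mu>) (\<lambda>(z, w). log_kernel z w)"
  have le: "?E \<le> ereal (\<phi> r)" if r: "0 < r" "r < 1" for r
  proof -
    let ?I = "\<integral>(z, w). reg_kernel r z w \<partial>(\<mu> \<Otimes>\<^sub>M \<mu>)"
    have int: "integrable (\<mu> \<Otimes>\<^sub>M \<mu>) (\<lambda>p. reg_kernel r (fst p) (snd p))"
      using integral_reg_kernel(1)[OF \<mu> r] by (simp add: case_prod_unfold)
    have "?E \<le> ereal (\<integral>p. reg_kernel r (fst p) (snd p) - ln r / 2 \<partial>(\<mu> \<Otimes>\<^sub>M \<mu>))"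
      using int by (intro ext_integral_le_integral)
        (auto simp: space_circle_pair[OF \<mu>] case_prod_unfold intro!: log_kernel_le_reg_kernel r)
    also have "(\<integral>p. reg_kernel r (fst p) (snd p) - ln r / 2 \<partial>(\<mu> \<Otimes>\<^sub>M \<mu>)) = ?I - ln r / 2"
      using int by (simp add: case_prod_unfold P.prob_space)
    also have "?I \<le> - (\<Sum>k=1..N. r ^ k * (cmod (moment \<mu> k))\<^sup>2 / real k)"
    proof -
      have s: "(\<lambda>n. r ^ n * (cmod (moment \<mu> n))\<^sup>2 / real n) sums (- ?I)"
        using sums_minus[OF integral_reg_kernel(2)[OF \<mu> r]] by simp
      \<comment> \<open>Every term of the series for - ?I is nonnegative, so its partial sums lie
        below it.\<close>
      have "(\<Sum>k=1..N. r ^ k * (cmod (moment \<mu> k))\<^sup>2 / real k) \<le> - ?I"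
        using sum_le_suminf[OF sums_summable[OF s], of "{1..N}"] r by (simp add: sums_unique[OF s, symmetric])
      then show ?thesis by simp
    qed
    finally show ?thesis
      by (simp add: \<phi>_def)
  qed
  have "(\<phi> \<longlongrightarrow> \<phi> 1) (at_left 1)"
    unfolding \<phi>_def by (auto intro!: tendsto_eq_intros)
  then have "((\<lambda>r. ereal (\<phi> r)) \<longlongrightarrow> ereal (\<phi> 1)) (at_left 1)"
    by simp
  moreover have "\<forall>\<^sub>F r in at_left 1. ?E \<le> ereal (\<phi> r)"
    using eventually_at_left_real[OF zero_less_one] by eventually_elim (auto intro: le)
  ultimately have "?E \<le> ereal (\<phi> 1)"
    by (intro tendsto_lowerbound) (auto simp: trivial_limit_at_left_real)
  then have "- ereal (\<phi> 1) \<le> - ?E"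
    by (rule ereal_minus_le_minus[THEN iffD2])
  then show ?thesis
    by (simp add: log_energy_def \<phi>_def flip: zero_ereal_def)
qed

lemma cis_int_Arg:
  assumes "z \<in> sphere 0 1"
  shows "cis (of_int (int k) * Arg z) = z ^ k" "cis (of_int (- int k) * Arg z) = cnj (z ^ k)"
proof -
  have z: "cis (Arg z) = z"
    using assms cis_Arg[of z] by (cases "z = 0") (simp_all add: sgn_div_norm)
  then show 1: "cis (of_int (int k) * Arg z) = z ^ k"
    using Complex.DeMoivre[of "Arg z" k] by simp
  show "cis (of_int (- int k) * Arg z) = cnj (z ^ k)"
    unfolding 1[symmetric] cis_cnj by simp
qed

lemma integral_cis_int_Arg:
  assumes "circle_prob \<mu>"
  shows "(\<integral>z. cis (of_int (int k) * Arg z) \<partial>\<mu>) = moment \<mu> k"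
    and "(\<integral>z. cis (of_int (- int k) * Arg z) \<partial>\<mu>) = cnj (moment \<mu> k)"
proof -
  show "(\<integral>z. cis (of_int (int k) * Arg z) \<partial>\<mu>) = moment \<mu> k"
    unfolding moment_def using circle_probD(2)[OF assms]
    by (intro Bochner_Integration.integral_cong refl cis_int_Arg) simp
  have "(\<integral>z. cis (of_int (- int k) * Arg z) \<partial>\<mu>) = (\<integral>z. cnj (z ^ k) \<partial>\<mu>)"
    using circle_probD(2)[OF assms]
    by (intro Bochner_Integration.integral_cong refl cis_int_Arg) simp
  then show "(\<integral>z. cis (of_int (- int k) * Arg z) \<partial>\<mu>) = cnj (moment \<mu> k)"
    by (simp add: moment_def del: complex_cnj_power)
qed

section \<open>The Haar measure: zero energy and uniqueness as minimizer\<close>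

lemma moment_circle_haar: "0 < k \<Longrightarrow> moment circle_haar k = 0"
  using integral_cis_int_Arg(1)[OF circle_prob_haar, of k] integral_circle_haar_cis_int[of "int k"] by simp

text \<open>The moments of positive order vanish, so every regularised kernel has integral 0.
  Fatou's lemma carries this to the logarithmic kernel in the direction opposite to
  \<open>log_energy_ge_moments\<close>.\<close>

lemma log_energy_circle_haar_le: "log_energy (\<lambda>_. 0) circle_haar \<le> 0"
proof -
  let ?M = "circle_haar \<Otimes>\<^sub>M circle_haar"
  note sp = space_circle_pair[OF circle_prob_haar]
  interpret P: prob_space ?M
    using circle_prob_haar by (rule prob_space_circle_pair)
  \<comment> \<open>The shift by 2 keeps \<open>r n\<close> strictly between 0 and 1 already for n =
    0.\<close>
  define r where "r n = 1 - 1 / (real n + 2)" for n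
  have r: "0 < r n" "r n < 1" for n
    by (auto simp: r_def field_simps)
  have r_lim: "r \<longlonglongrightarrow> 1"
    unfolding r_def by real_asymp
  define f where "f = (\<lambda>(z, w). log_kernel z w)"
  define F where "F n p = ln 2 - reg_kernel (r n) (fst p) (snd p)" for n p
  have f_meas [measurable]: "f \<in> borel_measurable ?M"
  proof (rule measurable_circle_pair[OF circle_prob_haar])
    have "(\<lambda>p. if fst p = snd p then - \<infinity> else ereal (ln (cmod (fst p - snd p)))) \<in>
        borel_measurable (borel \<Otimes>\<^sub>M borel)"
      by measurable
    then show "f \<in> borel_measurable (borel \<Otimes>\<^sub>M borel)"
      by (simp add: f_def log_kernel_def case_prod_unfold)
  qed
  have int: "integrable ?M (\<lambda>p. reg_kernel (r n) (fst p) (snd p))" for n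
    using integral_reg_kernel(1)[OF circle_prob_haar r] by (simp add: case_prod_unfold)
  have int0: "(\<integral>p. reg_kernel (r n) (fst p) (snd p) \<partial>?M) = 0" for n
  proof -
    have "(\<lambda>k. - (r n ^ k * (cmod (moment circle_haar k))\<^sup>2 / real k)) = (\<lambda>_. 0)"
      using moment_circle_haar by (intro ext) (case_tac k, auto)
    with integral_reg_kernel(2)[OF circle_prob_haar r, of n] show ?thesis
      by (simp add: case_prod_unfold sums_iff)
  qed
  have norm_1: "cmod (z * cnj w) = 1" if "cmod z = 1" "cmod w = 1" for z w
    using that by (simp add: norm_mult)
  have F_nonneg: "0 \<le> F n p" if "p \<in> space ?M" for n p
  proof -
    define x where "x = of_real (r n) * (fst p * cnj (snd p))"
    have "cmod (fst p * cnj (snd p)) = 1"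
      using that by (intro norm_1) (auto simp: sp)
    then have x: "cmod x = r n"
      using r[of n] unfolding x_def norm_mult[of "of_real (r n)"] by simp
    then have "1 - x \<noteq> 0" "cmod (1 - x) \<le> 2"
      using r[of n] norm_triangle_ineq4[of 1 x] by auto
    then have "ln (cmod (1 - x)) \<le> ln 2"
      by (subst ln_le_cancel_iff) auto
    then show ?thesis
      by (simp add: F_def reg_kernel_def x_def)
  qed
  have int_F: "(\<integral>\<^sup>+p. ennreal (F n p) \<partial>?M) = ennreal (ln 2)" for n
  proof -
    have "(\<integral>\<^sup>+p. ennreal (F n p) \<partial>?M) = ennreal (\<integral>p. F n p \<partial>?M)"
      using F_nonneg int by (intro nn_integral_eq_integral) (auto simp: F_def)
    also have "(\<integral>p. F n p \<partial>?M) = ln 2"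
      using int[of n] int0[of n] by (simp add: F_def P.prob_space)
    finally show ?thesis .
  qed
  have F_lim: "(\<lambda>n. ennreal (F n p)) \<longlonglongrightarrow> e2ennreal (ereal (ln 2) - f p)" if p: "p \<in> space ?M" for p
  proof -
    obtain z w where zw: "p = (z, w)" "cmod z = 1" "cmod w = 1"
      using p by (auto simp: sp)
    have ww: "w * cnj w = 1"
      using zw by (simp add: complex_norm_square[symmetric])
    show ?thesis
    proof (cases "z = w")
      case True
      \<comment> \<open>On the diagonal the approximants tend to \<infinity>, which is exactly ln 2
        minus the kernel there. The convergence thus holds at every point, and the diagonal need not
        be shown to be null.\<close>
      have "F n p = ln 2 + ln (real n + 2)" for n
      proof -
        have "reg_kernel (r n) w w = ln (cmod (of_real (1 - r n)))"
          unfolding reg_kernel_def ww by simp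
        also have "\<dots> = - ln (real n + 2)"
          unfolding norm_of_real by (simp add: r_def ln_div)
        finally show ?thesis
          by (simp add: F_def zw True)
      qed
      moreover have "filterlim (\<lambda>n. ln 2 + ln (real n + 2)) at_top sequentially"
        by real_asymp
      ultimately have "((\<lambda>n. ennreal (F n p)) \<longlongrightarrow> top) sequentially"
        using ennreal_tendsto_top_eq_at_top[of "\<lambda>n. F n p" sequentially] by simp
      then show ?thesis
        by (simp add: f_def zw True log_kernel_def)
    next
      case False
      have "z - w = w * (z * cnj w - 1)"
        using ww by (simp add: algebra_simps)
      then have eq: "cmod (1 - z * cnj w) = cmod (z - w)"
        using zw by (simp add: norm_mult norm_minus_commute)
      have "(\<lambda>n. cmod (1 - of_real (r n) * (z * cnj w))) \<longlonglongrightarrow> cmod (1 - of_real 1 * (z * cnj w))"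
        by (intro tendsto_intros r_lim)
      then have "(\<lambda>n. cmod (1 - of_real (r n) * (z * cnj w))) \<longlonglongrightarrow> cmod (z - w)"
        by (simp add: eq)
      then have "(\<lambda>n. ln 2 - ln (cmod (1 - of_real (r n) * (z * cnj w)))) \<longlonglongrightarrow> ln 2 - ln (cmod (z - w))"
        using False by (intro tendsto_diff[OF tendsto_const] tendsto_ln) auto
      then have "(\<lambda>n. ennreal (F n p)) \<longlonglongrightarrow> ennreal (ln 2 - ln (cmod (z - w)))"
        unfolding F_def reg_kernel_def zw(1) fst_conv snd_conv by (rule tendsto_ennrealI)
      then show ?thesis
        using False by (simp add: f_def zw log_kernel_def)
    qed
  qed
  \<comment> \<open>The shift by \<open>ln 2\<close>, an upper bound of the kernel, makes the integrands nonnegative.\<close>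
  have "(\<integral>\<^sup>+p. e2ennreal (ereal (ln 2) - f p) \<partial>?M) = (\<integral>\<^sup>+p. liminf (\<lambda>n. ennreal (F n p)) \<partial>?M)"
    by (intro nn_integral_cong lim_imp_Liminf[symmetric] F_lim) simp_all
  also have "\<dots> \<le> liminf (\<lambda>n. \<integral>\<^sup>+p. ennreal (F n p) \<partial>?M)"
    using int by (intro nn_integral_liminf) (auto simp: F_def)
  also have "\<dots> = ennreal (ln 2)"
    by (simp add: int_F Liminf_const)
  finally have Fatou: "(\<integral>\<^sup>+p. e2ennreal (ereal (ln 2) - f p) \<partial>?M) \<le> ennreal (ln 2)" .
  have f_le: "f p \<le> ereal (ln 2)" if p: "p \<in> space ?M" for p
  proof -
    obtain z w where zw: "p = (z, w)" "cmod z = 1" "cmod w = 1"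
      using p by (auto simp: sp)
    then have "cmod (z - w) \<le> 2"
      using norm_triangle_ineq4[of z w] by simp
    then show ?thesis
      using zw(1) by (auto simp: f_def log_kernel_def)
  qed
  \<comment> \<open>Positive and negative parts of f are compared through sums of nonnegative
    quantities. After integration the finite number ln 2 cancels.\<close>
  have split: "e2ennreal (ereal (ln 2) - f p) + e2ennreal (f p) = ennreal (ln 2) + e2ennreal (- f p)"
    if p: "p \<in> space ?M" for p
  proof (cases "f p")
    case (real x)
    then have x: "x \<le> ln 2"
      using f_le[OF p] by simp
    show ?thesis
    proof (cases "0 \<le> x")
      case True
      then show ?thesis
        using x real by (simp add: ennreal_neg flip: ennreal_plus)
    next
      case False
      then show ?thesis
        using x real by (simp add: ennreal_neg flip: ennreal_plus)
    qed
  qed (use f_le[OF p] in auto)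
  let ?P = "\<integral>\<^sup>+p. e2ennreal (f p) \<partial>?M" and ?N = "\<integral>\<^sup>+p. e2ennreal (- f p) \<partial>?M"
  have "ennreal (ln 2) + ?N = (\<integral>\<^sup>+p. ennreal (ln 2) + e2ennreal (- f p) \<partial>?M)"
    by (subst nn_integral_add) (auto simp: P.emeasure_space_1)
  also have "\<dots> = (\<integral>\<^sup>+p. e2ennreal (ereal (ln 2) - f p) + e2ennreal (f p) \<partial>?M)"
    by (intro nn_integral_cong split[symmetric])
  also have "\<dots> = (\<integral>\<^sup>+p. e2ennreal (ereal (ln 2) - f p) \<partial>?M) + ?P"
    by (rule nn_integral_add) auto
  also have "\<dots> \<le> ennreal (ln 2) + ?P"
    using Fatou by (rule add_right_mono)
  finally have "?N \<le> ?P"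
    by (simp add: ennreal_add_left_cancel_le)
  \<comment> \<open>Finiteness rules out \<infinity> - \<infinity> in \<open>ext_integral\<close>,
    so \<open>?N \<le> ?P\<close> really makes the difference nonnegative.\<close>
  moreover have "?P \<noteq> \<infinity>"
  proof -
    have "?P \<le> (\<integral>\<^sup>+p. ennreal (ln 2) \<partial>?M)"
      using f_le by (intro nn_integral_mono) (metis e2ennreal_ereal e2ennreal_mono)
    also have "\<dots> < \<infinity>"
      by (simp add: P.emeasure_space_1)
    finally show ?thesis by simp
  qed
  ultimately have "0 \<le> ext_integral ?M f"
    unfolding ext_integral_def by (cases ?P; cases ?N) (auto simp: ennreal_le_iff top_unique)
  then show ?thesis
    by (simp add: log_energy_def f_def flip: zero_ereal_def)
qed

lemma log_energy_nonneg: "circle_prob \<mu> \<Longrightarrow> 0 \<le> log_energy (\<lambda>_. 0) \<mu>"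
  using log_energy_ge_moments[of \<mu> 0] by (simp flip: zero_ereal_def)

lemma log_energy_circle_haar: "log_energy (\<lambda>_. 0) circle_haar = 0"
  by (intro antisym log_energy_circle_haar_le log_energy_nonneg circle_prob_haar)

text \<open>A single nonzero moment of positive order would make some partial sum, and hence the
  energy, positive. Moments of negative order are conjugates, and order 0 is the total mass.\<close>

lemma circle_haar_unique:
  assumes \<mu>: "circle_prob \<mu>" and le: "log_energy (\<lambda>_. 0) \<mu> \<le> 0"
  shows "\<mu> = circle_haar"
proof (rule circle_prob_eqI[OF \<mu> circle_prob_haar])
  have 0: "moment \<mu> k = 0" if "0 < k" for k
  proof -
    have "(\<Sum>j=1..k. (cmod (moment \<mu> j))\<^sup>2 / real j) \<le> 0"
      using order_trans[OF log_energy_ge_moments[OF \<mu>] le] by (simp add: zero_ereal_def)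
    moreover have "(cmod (moment \<mu> k))\<^sup>2 / real k \<le> (\<Sum>j=1..k. (cmod (moment \<mu> j))\<^sup>2 / real j)"
      using that by (intro member_le_sum) auto
    ultimately have "(cmod (moment \<mu> k))\<^sup>2 / real k \<le> 0"
      by linarith
    then show ?thesis
      using that by (simp add: divide_le_0_iff)
  qed
  have 1: "moment \<rho> 0 = 1" if "circle_prob \<rho>" for \<rho>
    using prob_space.prob_space[OF circle_probD(3)[OF that]] by (simp add: moment_def)
  have eq: "moment \<mu> k = moment circle_haar k" for k
    using 0 moment_circle_haar 1[OF \<mu>] 1[OF circle_prob_haar] by (cases "k = 0") auto
  show "(\<integral>z. cis (of_int k * Arg z) \<partial>\<mu>) = (\<integral>z. cis (of_int k * Arg z) \<partial>circle_haar)" for k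
  proof (cases k)
    case (nonneg n)
    then show ?thesis
      using integral_cis_int_Arg(1)[OF \<mu>, of n] integral_cis_int_Arg(1)[OF circle_prob_haar, of n] eq
      by simp
  next
    case (neg n)
    then show ?thesis
      using integral_cis_int_Arg(2)[OF \<mu>, of "Suc n"]
        integral_cis_int_Arg(2)[OF circle_prob_haar, of "Suc n"] eq
      by simp
  qed
qed

lemma equilibrium_measure_0: "equilibrium_measure (\<lambda>_. 0) = circle_haar"
  unfolding equilibrium_measure_def
proof (rule the_equality)
  show "is_energy_minimizer (\<lambda>_. 0) circle_haar"
    by (simp add: is_energy_minimizer_def circle_prob_haar log_energy_circle_haar log_energy_nonneg)
  show "\<mu> = circle_haar" if "is_energy_minimizer (\<lambda>_. 0) \<mu>" for \<mu>
    using that circle_haar_unique[of \<mu>] log_energy_circle_haar circle_prob_haar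
    unfolding is_energy_minimizer_def by metis
qed

section \<open>Parseval inequality for periodic functions\<close>

lemma integral_period_shift:
  fixes g :: "real \<Rightarrow> 'a::banach"
  assumes g: "continuous_on UNIV g" and per: "\<And>t. g (t + c) = g t" and "0 \<le> u" "0 \<le> c"
  shows "integral {u..u + c} g = integral {0..c} g"
proof -
  have int: "g integrable_on {a..b}" for a b
    by (intro integrable_continuous_interval continuous_on_subset[OF g]) auto
  have "integral {0..u} g + integral {u..u + c} g = integral {0..u + c} g"
    using assms by (intro Henstock_Kurzweil_Integration.integral_combine int) auto
  moreover have "integral {0..c} g + integral {c..u + c} g = integral {0..u + c} g"
    using assms by (intro Henstock_Kurzweil_Integration.integral_combine int) auto
  moreover have "integral {c..u + c} g = integral {0..u} g"
    using integral_shift_real_ivl[of c c "u + c" g] by (simp add: per)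
  ultimately show ?thesis
    by (metis add.commute add_left_cancel)
qed

text \<open>One antiderivative on the whole line, so that periodicity of the displacement can be
  discussed beyond a single window.\<close>

lemma ex_antiderivative:
  fixes g :: "real \<Rightarrow> real"
  assumes g: "continuous_on UNIV g"
  obtains G where "\<And>x. (G has_real_derivative g x) (at x)"
proof -
  have "isCont g x" for x
    using g by (simp add: continuous_on_eq_continuous_at)
  then have "\<exists>G. \<forall>x::real. - \<infinity> < ereal x \<longrightarrow> ereal x < \<infinity> \<longrightarrow> (G has_vector_derivative g x) (at x)"
    by (intro einterval_antiderivative) auto
  then show ?thesis
    using that by (auto simp: has_real_derivative_iff_has_vector_derivative)
qed

lemma integral_product_trig_sums:
  fixes c :: "int \<Rightarrow> complex"
  assumes "finite K"
  shows "integral {u..u + 2 * pi} (\<lambda>t. (\<Sum>k\<in>K. c k * cis (of_int k * t)) * cnj (\<Sum>k\<in>K. c k * cis (of_int k * t)))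
    = of_real (\<Sum>k\<in>K. 2 * pi * (cmod (c k))\<^sup>2)"
proof -
  have "integral {u..u + 2 * pi} (\<lambda>t. (\<Sum>k\<in>K. c k * cis (of_int k * t)) * cnj (\<Sum>k\<in>K. c k * cis (of_int k * t)))
      = integral {u..u + 2 * pi} (\<lambda>t. \<Sum>k\<in>K. \<Sum>j\<in>K. (c k * cnj (c j)) * cis (of_int (k - j) * t))"
  proof (rule integral_cong)
    fix t
    have "cis (of_int (k - j) * t) = cis (of_int k * t) * cnj (cis (of_int j * t))" for k j
      unfolding cis_cnj cis_mult by (simp add: left_diff_distrib)
    then show "(\<Sum>k\<in>K. c k * cis (of_int k * t)) * cnj (\<Sum>k\<in>K. c k * cis (of_int k * t)) =
        (\<Sum>k\<in>K. \<Sum>j\<in>K. (c k * cnj (c j)) * cis (of_int (k - j) * t))"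
      by (simp only: sum_product cnj_sum complex_cnj_mult mult_ac)
  qed
  also have "\<dots> = (\<Sum>k\<in>K. \<Sum>j\<in>K. integral {u..u + 2 * pi} (\<lambda>t. (c k * cnj (c j)) * cis (of_int (k - j) * t)))"
  proof -
    have "(\<lambda>t. d * cis (of_int l * t)) integrable_on {u..u + 2 * pi}" for d and l :: int
      by (intro integrable_continuous_interval continuous_intros)
    then show ?thesis
      using assms by (simp add: integral_sum integrable_sum del: of_int_diff)
  qed
  also have "\<dots> = (\<Sum>k\<in>K. \<Sum>j\<in>K. if k = j then of_real (2 * pi * (cmod (c k))\<^sup>2) else 0)"
  proof (intro sum.cong refl)
    fix k j
    show "integral {u..u + 2 * pi} (\<lambda>t. (c k * cnj (c j)) * cis (of_int (k - j) * t)) =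
        (if k = j then of_real (2 * pi * (cmod (c k))\<^sup>2) else 0)"
      unfolding Henstock_Kurzweil_Integration.integral_mult_right integral_cis_period
      by (simp add: complex_norm_square del: of_real_power)
  qed
  also have "\<dots> = of_real (\<Sum>k\<in>K. 2 * pi * (cmod (c k))\<^sup>2)"
    using assms by simp
  finally show ?thesis .
qed

text \<open>Completing the square: the left side is largest at c = a / s. It lets
  \<open>Parseval_le\<close> work with an approximant whose coefficients are not the Fourier
  coefficients.\<close>

lemma complex_cross_term_le:
  fixes a c :: complex and s :: real
  assumes "0 < s"
  shows "2 * Re (cnj c * a) - s * (cmod c)\<^sup>2 \<le> (cmod a)\<^sup>2 / s"
proof -
  have "Re (cnj c * a) \<le> cmod c * cmod a"
    using complex_Re_le_cmod[of "cnj c * a"] by (simp add: norm_mult)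
  moreover have "0 \<le> (s * cmod c - cmod a)\<^sup>2"
    by simp
  ultimately have "s * (2 * Re (cnj c * a) - s * (cmod c)\<^sup>2) \<le> (cmod a)\<^sup>2"
    using mult_left_mono[of "Re (cnj c * a)" "cmod c * cmod a" "2 * s"] assms
    by (simp add: power2_eq_square algebra_simps)
  then show ?thesis
    using assms by (simp add: field_simps)
qed

lemma periodic_Arg_cis:
  assumes "\<And>t. H (t + 2 * pi) = H t"
  shows "H (Arg (cis t)) = H t"
proof -
  interpret periodic_fun_simple H "2 * pi"
    using assms by unfold_locales
  have "cis (Arg (cis t)) = cis t"
    using cis_Arg[of "cis t"] by (simp add: sgn_div_norm)
  then have "sin (Arg (cis t)) = sin t \<and> cos (Arg (cis t)) = cos t"
    by (simp add: complex_eq_iff)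
  then obtain k :: int where "Arg (cis t) = t + 2 * pi * of_int k"
    using sin_cos_eq_iff by auto
  then show ?thesis
    using plus_of_int[of t k] by (simp add: mult.commute)
qed

lemma integral_complex_of_real_continuous:
  fixes f :: "real \<Rightarrow> real"
  assumes "continuous_on {a..b} f"
  shows "integral {a..b} (\<lambda>t. complex_of_real (f t)) = complex_of_real (integral {a..b} f)"
  using has_integral_of_real[OF integrable_integral[OF integrable_continuous_interval[OF assms]]]
  by (rule integral_unique)

text \<open>Take a trigonometric polynomial g within e of H and expand the integral of (H - g)^2,
  which is at most 2 pi e^2. The terms containing g are then bounded by their maximum over all
  choices of coefficients.\<close>

lemma Parseval_le:
  fixes H :: "real \<Rightarrow> real" and u :: real
  defines "a \<equiv> \<lambda>k::int. integral {u..u + 2 * pi} (\<lambda>t. of_real (H t) * cis (of_int (- k) * t))"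
  assumes H: "continuous_on UNIV H" and per: "\<And>t. H (t + 2 * pi) = H t" and e: "0 < e"
  obtains N :: nat where "integral {u..u + 2 * pi} (\<lambda>t. (H t)\<^sup>2) \<le>
    2 * pi * e\<^sup>2 + (\<Sum>k=-int N..int N. (cmod (a k))\<^sup>2) / (2 * pi)"
proof -
  let ?I = "{u..u + 2 * pi}"
  have "continuous_on (sphere 0 1) (\<lambda>z. H (Arg z))"
    by (rule continuous_on_sphere_if_cis) (unfold periodic_Arg_cis[of H, OF per], rule H)
  from Stone_Weierstrass_trig_poly[OF this e] obtain q where
    q: "trig_poly (\<lambda>t. complex_of_real (q (cis t)))" "continuous_on (sphere 0 1) q"
      "\<And>x. x \<in> sphere 0 1 \<Longrightarrow> \<bar>H (Arg x) - q x\<bar> < e"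
    by blast
  define g where "g t = q (cis t)" for t
  have gc: "continuous_on UNIV g"
    unfolding g_def using q(2) by (rule continuous_on_cis_comp)
  have close: "\<bar>H t - g t\<bar> < e" for t
    using q(3)[of "cis t"] periodic_Arg_cis[of H, OF per] by (simp add: g_def)
  from trig_poly_eq_sum[OF q(1)] obtain N c where
    "(\<lambda>t. complex_of_real (q (cis t))) = (\<lambda>t. \<Sum>k=-int N..int N. c k * cis (of_int k * t))"
    by blast
  then have g_sum: "complex_of_real (g t) = (\<Sum>k=-int N..int N. c k * cis (of_int k * t))" for t
    unfolding g_def by (rule fun_cong)
  have cont: "continuous_on ?I H" "continuous_on ?I g"
    using H gc continuous_on_subset by blast+
  define A where "A = integral ?I (\<lambda>t. (H t)\<^sup>2)"
  define B where "B = integral ?I (\<lambda>t. H t * g t)"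
  define C where "C = integral ?I (\<lambda>t. (g t)\<^sup>2)"
  have "complex_of_real B = integral ?I (\<lambda>t. complex_of_real (H t) * cnj (complex_of_real (g t)))"
    unfolding B_def using cont
    by (subst integral_complex_of_real_continuous[symmetric]) (auto intro!: continuous_intros)
  also have "\<dots> = integral ?I (\<lambda>t. \<Sum>k=-int N..int N. cnj (c k) * (of_real (H t) * cis (of_int (- k) * t)))"
    unfolding g_sum by (intro integral_cong) (simp add: sum_distrib_left cis_cnj mult_ac)
  also have "\<dots> = (\<Sum>k=-int N..int N. integral ?I (\<lambda>t. cnj (c k) * (of_real (H t) * cis (of_int (- k) * t))))"
    using cont by (intro integral_sum integrable_continuous_interval continuous_intros) auto
  also have "\<dots> = (\<Sum>k=-int N..int N. cnj (c k) * a k)"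
    unfolding Henstock_Kurzweil_Integration.integral_mult_right a_def ..
  finally have "complex_of_real B = (\<Sum>k=-int N..int N. cnj (c k) * a k)" .
  then have B: "B = (\<Sum>k=-int N..int N. Re (cnj (c k) * a k))"
    by (metis Re_complex_of_real Re_sum)
  have "complex_of_real C = integral ?I (\<lambda>t. complex_of_real (g t) * cnj (complex_of_real (g t)))"
    unfolding C_def using cont
    by (subst integral_complex_of_real_continuous[symmetric])
       (auto intro!: continuous_intros simp: power2_eq_square)
  also have "\<dots> = complex_of_real (\<Sum>k=-int N..int N. 2 * pi * (cmod (c k))\<^sup>2)"
    unfolding g_sum by (rule integral_product_trig_sums) simp
  finally have C: "C = (\<Sum>k=-int N..int N. 2 * pi * (cmod (c k))\<^sup>2)"
    by (simp only: of_real_eq_iff)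
  have "((\<lambda>t. (H t)\<^sup>2 - 2 * (H t * g t) + (g t)\<^sup>2) has_integral (A - 2 * B + C)) ?I"
    unfolding A_def B_def C_def using cont
    by (intro has_integral_add has_integral_diff has_integral_mult_right integrable_integral
        integrable_continuous_interval continuous_intros)
  then have "A - 2 * B + C = integral ?I (\<lambda>t. (H t)\<^sup>2 - 2 * (H t * g t) + (g t)\<^sup>2)"
    by (rule integral_unique[symmetric])
  also have "\<dots> \<le> integral ?I (\<lambda>_. e\<^sup>2)"
  proof (rule integral_le)
    fix t
    have "\<bar>H t - g t\<bar>\<^sup>2 \<le> e\<^sup>2"
      using close[of t] by (intro power_mono) auto
    then show "(H t)\<^sup>2 - 2 * (H t * g t) + (g t)\<^sup>2 \<le> e\<^sup>2"
      by (simp add: power2_eq_square algebra_simps)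
  qed (use cont in \<open>auto intro!: integrable_continuous_interval continuous_intros\<close>)
  also have "\<dots> = 2 * pi * e\<^sup>2"
    by simp
  finally have "A \<le> 2 * pi * e\<^sup>2 + (2 * B - C)"
    by simp
  \<comment> \<open>The expression splits into one independent term per frequency, each of the shape
    treated by \<open>complex_cross_term_le\<close> with s = 2 pi.\<close>
  also have "2 * B - C = (\<Sum>k=-int N..int N. 2 * Re (cnj (c k) * a k) - 2 * pi * (cmod (c k))\<^sup>2)"
    unfolding B C sum_subtractf sum_distrib_left ..
  also have "\<dots> \<le> (\<Sum>k=-int N..int N. (cmod (a k))\<^sup>2 / (2 * pi))"
    by (intro sum_mono complex_cross_term_le) simp
  finally show ?thesis
    using that by (simp add: A_def sum_divide_distrib)
qed

lemma sum_symmetric_int_interval: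
  fixes b :: "int \<Rightarrow> 'a::comm_monoid_add"
  shows "(\<Sum>k=-int N..int N. b k) = b 0 + (\<Sum>k=1..N. b (int k) + b (- int k))"
proof (induction N)
  case (Suc N)
  have "{-int (Suc N)..int (Suc N)} = insert (int (Suc N)) (insert (- int (Suc N)) {-int N..int N})"
    by auto
  then show ?case
    by (simp add: Suc.IH ac_simps)
qed simp

text \<open>Integration by parts over a full period: the boundary terms cancel, and the constant 1
  in H' = p - 1 affects only frequency 0, which the mean condition removes. The frequencies k and -k
  contribute equally, hence the factor 2.\<close>

lemma variance_le_fourier:
  fixes p H :: "real \<Rightarrow> real" and u :: real
  defines "m \<equiv> \<lambda>k::nat. integral {u..u + 2 * pi} (\<lambda>t. of_real (p t) * cis (of_nat k * t))"
  assumes p: "continuous_on UNIV p"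
    and H: "\<And>t. (H has_real_derivative p t - 1) (at t)" and per: "\<And>t. H (t + 2 * pi) = H t"
    and mean: "integral {u..u + 2 * pi} H = 0" and e: "0 < e"
  obtains N where "integral {u..u + 2 * pi} (\<lambda>t. (H t)\<^sup>2) \<le>
    2 * pi * e\<^sup>2 + (\<Sum>k=1..N. 2 * (cmod (m k))\<^sup>2 / (real k)\<^sup>2) / (2 * pi)"
proof -
  let ?I = "{u..u + 2 * pi}"
  define a where "a k = integral ?I (\<lambda>t. of_real (H t) * cis (of_int (- k) * t))" for k :: int
  have Hc: "continuous_on UNIV H"
    using H by (meson DERIV_isCont continuous_at_imp_continuous_on)
  have cont: "continuous_on ?I H" "continuous_on ?I p"
    using Hc p continuous_on_subset by blast+
  have a0: "a 0 = 0"
    using mean cont by (simp add: a_def integral_complex_of_real_continuous)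
  have ak: "of_int k * (\<i> * a k) = integral ?I (\<lambda>t. of_real (p t) * cis (of_int (- k) * t))"
    if "k \<noteq> 0" for k
  proof -
    let ?F = "\<lambda>t. of_real (H t) * cis (of_int (- k) * t)"
    let ?f = "\<lambda>t. of_real (p t - 1) * cis (of_int (- k) * t) - (\<i> * of_int k) * ?F t"
    have "(?f has_integral (?F (u + 2 * pi) - ?F u)) ?I"
    proof (rule fundamental_theorem_of_calculus)
      fix t
      have "((\<lambda>t. complex_of_real (H t)) has_vector_derivative of_real (p t - 1)) (at t within ?I)"
        using bounded_linear.has_vector_derivative[OF bounded_linear_of_real
            has_vector_derivative_at_within[OF H[of t, unfolded has_real_derivative_iff_has_vector_derivative]]] .
      from has_vector_derivative_mult[OF this has_vector_derivative_cis_mult[of "of_int (- k)" t ?I]]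
      show "(?F has_vector_derivative ?f t) (at t within ?I)"
        by (simp add: algebra_simps)
    qed simp
    moreover have "?F (u + 2 * pi) = ?F u"
    proof -
      have "cis (of_int (- k) * (u + 2 * pi)) = cis (of_int (- k) * u) * cis (2 * pi * of_int (- k))"
        unfolding cis_mult by (simp add: algebra_simps)
      then show ?thesis
        by (simp add: per del: of_int_minus)
    qed
    ultimately have 1: "(?f has_integral 0) ?I"
      by simp
    have 2: "((\<lambda>t. of_real (p t) * cis (of_int (- k) * t) - cis (of_int (- k) * t) - (\<i> * of_int k) * ?F t)
        has_integral (integral ?I (\<lambda>t. of_real (p t) * cis (of_int (- k) * t)) -
          integral ?I (\<lambda>t. cis (of_int (- k) * t)) - (\<i> * of_int k) * a k)) ?I"
      unfolding a_def using cont
      by (intro has_integral_diff has_integral_mult_right integrable_integral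
        integrable_continuous_interval continuous_intros)
    have 3: "?f = (\<lambda>t. of_real (p t) * cis (of_int (- k) * t) - cis (of_int (- k) * t) - (\<i> * of_int k) * ?F t)"
      by (simp add: left_diff_distrib)
    have "integral ?I (\<lambda>t. of_real (p t) * cis (of_int (- k) * t)) -
          integral ?I (\<lambda>t. cis (of_int (- k) * t)) - (\<i> * of_int k) * a k = 0"
      by (rule has_integral_unique[OF 2 1[unfolded 3]])
    then show ?thesis
      using that integral_cis_period[of u "- k"] by (simp add: algebra_simps)
  qed
  have neg: "(cmod (a (- int k)))\<^sup>2 = (cmod (m k))\<^sup>2 / (real k)\<^sup>2" if "0 < k" for k
  proof -
    have "real k * cmod (a (- int k)) = cmod (m k)"
      using that arg_cong[OF ak[of "- int k"], of cmod] by (simp add: m_def norm_mult)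
    from this[symmetric] show ?thesis
      using that by (simp add: power_mult_distrib)
  qed
  \<comment> \<open>\<open>m k\<close> carries the frequency +k and so matches
    \<open>a (- int k)\<close> directly; for \<open>a (int k)\<close> it is conjugated, p being
    real.\<close>
  have pos: "(cmod (a (int k)))\<^sup>2 = (cmod (m k))\<^sup>2 / (real k)\<^sup>2" if "0 < k" for k
  proof -
    have "cnj (m k) = integral ?I (\<lambda>t. of_real (p t) * cis (of_int (- int k) * t))"
      unfolding m_def Henstock_Kurzweil_Integration.integral_cnj
      by (intro integral_cong) (simp add: cis_cnj)
    then have "real k * cmod (a (int k)) = cmod (cnj (m k))"
      using that arg_cong[OF ak[of "int k"], of cmod] by (simp add: norm_mult)
    then have "real k * cmod (a (int k)) = cmod (m k)"
      by simp
    from this[symmetric] show ?thesis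
      using that by (simp add: power_mult_distrib)
  qed
  obtain N where N: "integral ?I (\<lambda>t. (H t)\<^sup>2) \<le>
      2 * pi * e\<^sup>2 + (\<Sum>k=-int N..int N. (cmod (a k))\<^sup>2) / (2 * pi)"
    unfolding a_def using Parseval_le[OF Hc per e] by blast
  have "(\<Sum>k=-int N..int N. (cmod (a k))\<^sup>2) = (\<Sum>k=1..N. 2 * (cmod (m k))\<^sup>2 / (real k)\<^sup>2)"
    unfolding sum_symmetric_int_interval by (simp add: a0, intro sum.cong) (auto simp: pos neg)
  with N show ?thesis
    using that by simp
qed

section \<open>Lifts to the real line\<close>

text \<open>The density is defined on the angles [0, 2 pi), and translation by 2 n pi identifies
  these with the n-th branch without changing Lebesgue measure or the periodic density.\<close>

lemma emeasure_circle_density_cis_image: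
  fixes n :: int
  assumes f: "continuous_on (sphere 0 1) f" "\<And>x. x \<in> sphere 0 1 \<Longrightarrow> 0 \<le> f x"
    and B: "B \<in> sets borel"
  shows "emeasure (density circle_haar (\<lambda>x. ennreal (f x)))
      (cis ` (B \<inter> {2 * of_int n * pi..<2 * (of_int n + 1) * pi})) =
    (\<integral>\<^sup>+x. ennreal (f (cis x) / (2 * pi)) *
      indicator (B \<inter> {2 * of_int n * pi..<2 * (of_int n + 1) * pi}) x \<partial>lborel)"
    (is "_ (cis ` (B \<inter> ?I)) = integral\<^sup>N lborel ?F")
proof -
  have cis_shift: "cis (2 * of_int n * pi + t) = cis t" for t
  proof -
    have "cis (2 * of_int n * pi + t) = cis (2 * pi * of_int n) * cis t"
      unfolding cis_mult by (simp add: algebra_simps)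
    then show ?thesis by simp
  qed
  have q: "continuous_on UNIV (\<lambda>t. f (cis t) / (2 * pi))"
    by (intro continuous_intros continuous_on_cis_comp f) auto
  then have [measurable]: "(\<lambda>t. f (cis t) / (2 * pi)) \<in> borel_measurable borel"
    by (rule borel_measurable_continuous_onI)
  have [measurable]: "B \<in> sets borel"
    by (rule B)
  have img: "cis ` (B \<inter> ?I) \<in> sets circle_borel"
    using B by (rule cis_image_measurable)
  have mem: "cis t \<in> cis ` (B \<inter> ?I) \<longleftrightarrow> 2 * of_int n * pi + t \<in> B" if "t \<in> {0..<2 * pi}" for t
  proof
    assume "cis t \<in> cis ` (B \<inter> ?I)"
    then obtain x where x: "cis t = cis x" "x \<in> B" "x \<in> ?I"
      by auto
    then have "sin t = sin x \<and> cos t = cos x"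
      by (simp add: complex_eq_iff)
    then obtain k :: int where k: "t = x + 2 * pi * of_int k"
      using sin_cos_eq_iff by auto
    \<comment> \<open>Both t and x - 2 n pi lie in [0, 2 pi), and their difference is 2 pi (n +
      k).\<close>
    have "\<bar>of_int (n + k) :: real\<bar> < 1"
    proof -
      have "2 * pi * of_int (n + k) < 2 * pi * 1" "2 * pi * (- 1) < 2 * pi * of_int (n + k)"
        using x(3) that k by (auto simp: algebra_simps)
      then show ?thesis
        by (simp only: mult_less_cancel_left_pos pi_gt_zero mult_pos_pos zero_less_numeral)
    qed
    then have "n + k = 0"
      by linarith
    then have "k = - n" by simp
    then show "2 * of_int n * pi + t \<in> B"
      using x(2) k by (simp add: mult_ac)
  next
    assume "2 * of_int n * pi + t \<in> B"
    moreover have "2 * of_int n * pi + t \<in> ?I"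
      using that by (auto simp: algebra_simps)
    ultimately show "cis t \<in> cis ` (B \<inter> ?I)"
      using cis_shift[of t] by (metis IntI imageI)
  qed
  have I_iff: "2 * of_int n * pi + t \<in> ?I \<longleftrightarrow> t \<in> {0..<2 * pi}" for t
    by (auto simp: algebra_simps)
  have "emeasure (density circle_haar (\<lambda>x. ennreal (f x))) (cis ` (B \<inter> ?I)) =
      emeasure (interval_density (\<lambda>t. f (cis t) / (2 * pi)) 0 (2 * pi)) (cis -` (cis ` (B \<inter> ?I)))"
  proof -
    have "density circle_haar (\<lambda>x. ennreal (f x)) =
        distr (interval_density (\<lambda>t. f (cis t) / (2 * pi)) 0 (2 * pi)) circle_borel cis"
      using f by (rule density_circle_haar_eq_distr)
    then show ?thesis
      using img by (simp add: emeasure_distr)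
  qed
  also have "\<dots> = (\<integral>\<^sup>+t. ennreal (f (cis t) / (2 * pi)) * indicator {0..<2 * pi} t *
      indicator (cis -` (cis ` (B \<inter> ?I))) t \<partial>lborel)"
    using measurable_sets[OF cis_measurable_circle img] by (subst emeasure_density) auto
  also have "\<dots> = (\<integral>\<^sup>+t. ?F (2 * of_int n * pi + 1 * t) \<partial>lborel)"
  proof (intro nn_integral_cong)
    fix t
    show "ennreal (f (cis t) / (2 * pi)) * indicator {0..<2 * pi} t * indicator (cis -` (cis ` (B \<inter> ?I))) t =
        ?F (2 * of_int n * pi + 1 * t)"
      using mem[of t] I_iff[of t] by (auto simp: indicator_def cis_shift)
  qed
  also have "\<dots> = integral\<^sup>N lborel ?F"
    by (subst nn_integral_real_affine[where c = 1 and t = "2 * of_int n * pi" and f = ?F]) auto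
  finally show ?thesis .
qed

lemma circle_lift_at_density:
  assumes f: "continuous_on (sphere 0 1) f" "\<And>x. x \<in> sphere 0 1 \<Longrightarrow> 0 \<le> f x"
    and u: "u \<in> {0..2 * pi}"
  shows "circle_lift_at u (density circle_haar (\<lambda>x. ennreal (f x))) =
    interval_density (\<lambda>x. f (cis x) / (2 * pi)) u (u + 2 * pi)"
    (is "circle_lift_at u ?\<mu> = interval_density ?q u _")
proof (rule measure_eqI)
  show "sets (circle_lift_at u ?\<mu>) = sets (interval_density ?q u (u + 2 * pi))"
    by (simp add: circle_lift_at_def sets_circle_lift)
  fix A assume "A \<in> sets (circle_lift_at u ?\<mu>)"
  then have A [measurable]: "A \<in> sets borel"
    by (simp add: circle_lift_at_def sets_circle_lift)
  let ?S = "{u..<u + 2 * pi}"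
  let ?I = "\<lambda>n::int. {2 * of_int n * pi..<2 * (of_int n + 1) * pi}"
  have "continuous_on UNIV ?q"
    by (intro continuous_intros continuous_on_cis_comp f) auto
  then have [measurable]: "?q \<in> borel_measurable borel"
    by (rule borel_measurable_continuous_onI)
  note [measurable_cong] = sets_circle_lift
  have sets: "sets ?\<mu> = sets circle_borel"
    by (simp add: sets_circle_haar)
  \<comment> \<open>For u in [0, 2 pi] the window lies in [0, 4 pi), so only the branches 0 and 1
    survive in the infinite sum.\<close>
  have disj: "(A \<inter> ?S) \<inter> ?I n = {}" if "n \<noteq> 0" "n \<noteq> 1" for n
  proof -
    consider "n + 1 \<le> 0" | "2 \<le> n"
      using \<open>n \<noteq> 0\<close> \<open>n \<noteq> 1\<close> by linarith
    then show ?thesis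
    proof cases
      case 1
      then have "real_of_int n + 1 \<le> 0"
        by linarith
      then have "2 * (real_of_int n + 1) * pi \<le> 0"
        using mult_right_mono[of "2 * (real_of_int n + 1)" 0 pi] by simp
      then show ?thesis
        using u by auto
    next
      case 2
      then have "2 \<le> real_of_int n"
        by linarith
      then have ge: "2 * 2 * pi \<le> 2 * real_of_int n * pi"
        by (intro mult_right_mono) auto
      show ?thesis
      proof (rule equals0I)
        fix x assume "x \<in> (A \<inter> ?S) \<inter> ?I n"
        then have "x < u + 2 * pi" "2 * real_of_int n * pi \<le> x"
          by auto
        then show False
          using u ge unfolding atLeastAtMost_iff by linarith
      qed
    qed
  qed
  have "emeasure (circle_lift_at u ?\<mu>) A =
      (\<integral>\<^sup>+x. indicator ?S x * indicator A x \<partial>circle_lift ?\<mu>)"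
    unfolding circle_lift_at_def by (rule emeasure_density) measurable
  also have "\<dots> = (\<integral>\<^sup>+x. indicator (A \<inter> ?S) x \<partial>circle_lift ?\<mu>)"
    by (intro nn_integral_cong) (auto simp: indicator_def)
  also have "\<dots> = emeasure (circle_lift ?\<mu>) (A \<inter> ?S)"
    by (rule nn_integral_indicator) measurable
  also have "\<dots> = (\<Sum>\<^sub>\<infinity>n::int. emeasure ?\<mu> (cis ` ((A \<inter> ?S) \<inter> ?I n)))"
    by (rule emeasure_circle_lift[OF sets]) measurable
  also have "\<dots> = (\<Sum>\<^sub>\<infinity>n\<in>{0, 1::int}. emeasure ?\<mu> (cis ` ((A \<inter> ?S) \<inter> ?I n)))"
  proof -
    have "emeasure ?\<mu> (cis ` ((A \<inter> ?S) \<inter> ?I n)) = 0" if "n \<notin> {0, 1}" for n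
      using that disj[of n] by simp
    then show ?thesis
      by (intro infsum_cong_neutral) blast+
  qed
  also have "\<dots> = emeasure ?\<mu> (cis ` ((A \<inter> ?S) \<inter> ?I 0)) + emeasure ?\<mu> (cis ` ((A \<inter> ?S) \<inter> ?I 1))"
    by simp
  also have "\<dots> = (\<integral>\<^sup>+x. ennreal (?q x) * indicator ((A \<inter> ?S) \<inter> ?I 0) x \<partial>lborel) +
      (\<integral>\<^sup>+x. ennreal (?q x) * indicator ((A \<inter> ?S) \<inter> ?I 1) x \<partial>lborel)"
    by (intro arg_cong2[where f = "(+)"] emeasure_circle_density_cis_image f) simp_all
  also have "\<dots> = (\<integral>\<^sup>+x. ennreal (?q x) * indicator ((A \<inter> ?S) \<inter> ?I 0) x +
      ennreal (?q x) * indicator ((A \<inter> ?S) \<inter> ?I 1) x \<partial>lborel)"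
    by (rule nn_integral_add[symmetric]) measurable
  also have "\<dots> = (\<integral>\<^sup>+x. ennreal (?q x) * indicator ?S x * indicator A x \<partial>lborel)"
    using u by (intro nn_integral_cong) (auto simp: indicator_def)
  also have "\<dots> = emeasure (interval_density ?q u (u + 2 * pi)) A"
    by (rule emeasure_density[symmetric]) auto
  finally show "emeasure (circle_lift_at u ?\<mu>) A = emeasure (interval_density ?q u (u + 2 * pi)) A" .
qed

lemma smooth_on_circle_imp_continuous:
  assumes "smooth_on_circle f"
  shows "continuous_on (sphere 0 1) f"
proof -
  have "((deriv ^^ 0) (\<lambda>s. f (cis s))) differentiable (at t)" for t
    using assms unfolding smooth_on_circle_def by blast
  then have "(\<lambda>s. f (cis s)) differentiable (at t)" for t
    by simp
  then have "isCont (\<lambda>s. f (cis s)) t" for t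
    using differentiable_imp_continuous_within by blast
  then show ?thesis
    by (intro continuous_on_sphere_if_cis continuous_at_imp_continuous_on) auto
qed

text \<open>Change of variables for a nondecreasing g. Where q vanishes g may be constant, so no
  inverse of g is formed; the substitution rule asks only for a nonnegative derivative.\<close>

lemma distr_interval_density:
  fixes g :: "real \<Rightarrow> real"
  assumes q: "continuous_on UNIV q" "\<And>x. 0 \<le> q x" and ab: "a \<le> b" and c: "0 < c"
    and g: "\<And>x. (g has_real_derivative q x * c) (at x)"
  shows "distr (interval_density q a b) borel g = interval_density (\<lambda>_. 1 / c) (g a) (g b)"
proof (rule measure_eqI)
  have gc: "continuous_on UNIV g"
    using g by (meson DERIV_isCont continuous_at_imp_continuous_on)
  have [measurable]: "g \<in> borel_measurable borel" "q \<in> borel_measurable borel"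
    using gc q(1) by (auto intro: borel_measurable_continuous_onI)
  fix A assume "A \<in> sets (distr (interval_density q a b) borel g)"
  then have A [measurable]: "A \<in> sets borel"
    by simp
  have gA [measurable]: "g -` A \<in> sets borel"
    using measurable_sets[OF \<open>g \<in> borel_measurable borel\<close> A] by simp
  have "emeasure (distr (interval_density q a b) borel g) A = emeasure (interval_density q a b) (g -` A)"
    by (subst emeasure_distr) auto
  also have "\<dots> = (\<integral>\<^sup>+x. ennreal (q x) * indicator {a..<b} x * indicator (g -` A) x \<partial>lborel)"
    by (rule emeasure_density) auto
  also have "\<dots> = (\<integral>\<^sup>+x. ennreal (indicator A (g x) / c * (q x * c) * indicator {a..b} x) \<partial>lborel)"
  proof (rule nn_integral_cong_AE)
    have "AE x in lborel. x \<noteq> b"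
      by (rule AE_lborel_singleton)
    then show "AE x in lborel. ennreal (q x) * indicator {a..<b} x * indicator (g -` A) x =
        ennreal (indicator A (g x) / c * (q x * c) * indicator {a..b} x)"
      by eventually_elim (use c in \<open>auto simp: indicator_def\<close>)
  qed
  also have "\<dots> = (\<integral>\<^sup>+x. ennreal (indicator A x / c * indicator {g a..g b} x) \<partial>lborel)"
  proof (rule nn_integral_substitution[symmetric])
    show "set_borel_measurable borel {g a..g b} (\<lambda>x. indicator A x / c)"
      unfolding set_borel_measurable_def by measurable
  qed (use q c g ab in \<open>auto intro!: continuous_intros continuous_on_subset[OF q(1)]\<close>)
  also have "\<dots> = (\<integral>\<^sup>+x. ennreal (1 / c) * indicator {g a..<g b} x * indicator A x \<partial>lborel)"
  proof (rule nn_integral_cong_AE)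
    have "AE x in lborel. x \<noteq> g b"
      by (rule AE_lborel_singleton)
    then show "AE x in lborel. ennreal (indicator A x / c * indicator {g a..g b} x) =
        ennreal (1 / c) * indicator {g a..<g b} x * indicator A x"
      by eventually_elim (use c in \<open>auto simp: indicator_def\<close>)
  qed
  also have "\<dots> = emeasure (interval_density (\<lambda>_. 1 / c) (g a) (g b)) A"
    by (rule emeasure_density[symmetric]) auto
  finally show "emeasure (distr (interval_density q a b) borel g) A =
      emeasure (interval_density (\<lambda>_. 1 / c) (g a) (g b)) A" .
qed simp

section \<open>The transport inequality\<close>

lemma wasserstein_2_le:
  assumes "\<pi> \<in> couplings \<mu> \<nu>" and "(\<integral>\<^sup>+z. ennreal (\<bar>fst z - snd z\<bar> powr 2) \<partial>\<pi>) \<le> ennreal c"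
    and "0 \<le> c"
  shows "wasserstein 2 \<mu> \<nu> \<le> ennreal (sqrt c)"
proof -
  define I where "I = (INF \<pi>\<in>couplings \<mu> \<nu>. \<integral>\<^sup>+z. ennreal (\<bar>fst z - snd z\<bar> powr 2) \<partial>\<pi>)"
  have "I \<le> (\<integral>\<^sup>+z. ennreal (\<bar>fst z - snd z\<bar> powr 2) \<partial>\<pi>)"
    unfolding I_def using assms(1) by (rule INF_lower)
  also have "\<dots> \<le> ennreal c"
    by (rule assms(2))
  finally have le: "I \<le> ennreal c" .
  then have "I \<noteq> \<infinity>"
    by (auto simp: top_unique)
  have "enn2real I \<le> c"
    using enn2real_mono[OF le] assms(3) by simp
  then have "enn2real I powr (1 / 2) \<le> sqrt c"
    by (simp add: powr_half_sqrt)
  then show ?thesis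
    using \<open>I \<noteq> \<infinity>\<close> unfolding wasserstein_def I_def[symmetric] ennreal_powr_def
    by (auto intro: ennreal_leI)
qed

lemma graph_coupling:
  assumes "sets \<mu> = sets borel" and "g \<in> borel_measurable borel"
  shows "distr \<mu> (borel \<Otimes>\<^sub>M borel) (\<lambda>x. (x, g x)) \<in> couplings \<mu> (distr \<mu> borel g)"
proof -
  note [measurable_cong] = assms(1) and [measurable] = assms(2)
  have "distr (distr \<mu> (borel \<Otimes>\<^sub>M borel) (\<lambda>x. (x, g x))) borel fst = distr \<mu> borel (\<lambda>x. x)"
    by (subst distr_distr) (auto simp: comp_def)
  also have "\<dots> = \<mu>"
    using assms(1) by (simp add: distr_id2)
  finally have 1: "distr (distr \<mu> (borel \<Otimes>\<^sub>M borel) (\<lambda>x. (x, g x))) borel fst = \<mu>" .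
  have 2: "distr (distr \<mu> (borel \<Otimes>\<^sub>M borel) (\<lambda>x. (x, g x))) borel snd = distr \<mu> borel g"
    by (subst distr_distr) (auto simp: comp_def)
  show ?thesis
    unfolding couplings_def using 1 2 by simp
qed

text \<open>The monotone transport map from \<open>p / 2\<pi>\<close> to the uniform density is \<open>x \<mapsto> x + H x\<close>.\<close>

lemma wasserstein_2_uniform_le:
  fixes p H :: "real \<Rightarrow> real"
  assumes p: "continuous_on UNIV p" "\<And>t. 0 \<le> p t"
    and H: "\<And>t. (H has_real_derivative p t - 1) (at t)" and per: "H (u + 2 * pi) = H u"
  shows "wasserstein 2 (interval_density (\<lambda>t. p t / (2 * pi)) u (u + 2 * pi))
      (interval_density (\<lambda>_. 1 / (2 * pi)) (u + H u) (u + H u + 2 * pi)) \<le>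
    ennreal (sqrt (integral {u..u + 2 * pi} (\<lambda>t. (H t)\<^sup>2) / (2 * pi)))"
proof -
  let ?\<mu> = "interval_density (\<lambda>t. p t / (2 * pi)) u (u + 2 * pi)"
  let ?I = "{u..u + 2 * pi}"
  have Hc: "continuous_on UNIV H"
    using H by (meson DERIV_isCont continuous_at_imp_continuous_on)
  have q: "continuous_on UNIV (\<lambda>t. p t / (2 * pi))" "\<And>t. 0 \<le> p t / (2 * pi)"
    using p by (auto intro!: continuous_intros)
  have cont: "continuous_on ?I H" "continuous_on ?I p"
    using Hc p(1) continuous_on_subset by blast+
  define g where "g x = x + H x" for x
  have g: "(g has_real_derivative p x / (2 * pi) * (2 * pi)) (at x)" for x
    unfolding g_def using DERIV_add[OF DERIV_ident H[of x]] by simp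
  have gm [measurable]: "g \<in> borel_measurable borel"
    unfolding g_def by (intro borel_measurable_continuous_onI continuous_intros Hc)
  have [measurable]: "H \<in> borel_measurable borel"
    using Hc by (rule borel_measurable_continuous_onI)
  have "distr ?\<mu> borel g = interval_density (\<lambda>_. 1 / (2 * pi)) (g u) (g (u + 2 * pi))"
    by (rule distr_interval_density[OF q _ _ g]) auto
  moreover have "g u = u + H u" "g (u + 2 * pi) = u + H u + 2 * pi"
    by (simp_all add: g_def per)
  ultimately have distr: "distr ?\<mu> borel g = interval_density (\<lambda>_. 1 / (2 * pi)) (u + H u) (u + H u + 2 * pi)"
    by (simp only:)
  have "(\<integral>\<^sup>+z. ennreal (\<bar>fst z - snd z\<bar> powr 2) \<partial>distr ?\<mu> (borel \<Otimes>\<^sub>M borel) (\<lambda>x. (x, g x))) =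
      (\<integral>\<^sup>+x. ennreal (\<bar>x - g x\<bar> powr 2) \<partial>?\<mu>)"
    by (subst nn_integral_distr) auto
  also have "\<dots> = (\<integral>\<^sup>+x. ennreal ((H x)\<^sup>2) \<partial>?\<mu>)"
    by (intro nn_integral_cong) (simp add: g_def powr_numeral)
  also have "\<dots> = ennreal (integral ?I (\<lambda>t. p t / (2 * pi) * (H t)\<^sup>2))"
    by (intro nn_integral_interval_density q continuous_intros Hc) auto
  also have "integral ?I (\<lambda>t. p t / (2 * pi) * (H t)\<^sup>2) = integral ?I (\<lambda>t. (H t)\<^sup>2) / (2 * pi)"
  proof -
    \<comment> \<open>Since H' = p - 1, the integrand is the derivative of H^3 / 3 and integrates to
      0 over a period. This trades the weight p in the cost for the weight 1.\<close>
    have a: "((\<lambda>t. (H t)\<^sup>2 * (p t - 1)) has_integral ((H (u + 2 * pi))^3 / 3 - (H u)^3 / 3)) ?I"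
    proof (rule fundamental_theorem_of_calculus)
      fix t
      have "((\<lambda>t. (H t)^3 / 3) has_real_derivative ((H t)\<^sup>2 * (p t - 1))) (at t)"
        using H[of t] by (auto intro!: derivative_eq_intros)
      then show "((\<lambda>t. (H t)^3 / 3) has_vector_derivative ((H t)\<^sup>2 * (p t - 1))) (at t within ?I)"
        by (simp add: has_real_derivative_iff_has_vector_derivative has_vector_derivative_at_within)
    qed simp
    have b: "((\<lambda>t. (H t)\<^sup>2) has_integral integral ?I (\<lambda>t. (H t)\<^sup>2)) ?I"
      by (intro integrable_integral integrable_continuous_interval continuous_intros cont)
    have "((\<lambda>t. (H t)\<^sup>2 * (p t - 1) + (H t)\<^sup>2) has_integral integral ?I (\<lambda>t. (H t)\<^sup>2)) ?I"
      using has_integral_add[OF a b] by (simp only: per diff_self add_0)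
    then have "((\<lambda>t. ((H t)\<^sup>2 * (p t - 1) + (H t)\<^sup>2) / (2 * pi)) has_integral
        integral ?I (\<lambda>t. (H t)\<^sup>2) / (2 * pi)) ?I"
      by (rule has_integral_divide)
    moreover have "(\<lambda>t. ((H t)\<^sup>2 * (p t - 1) + (H t)\<^sup>2) / (2 * pi)) = (\<lambda>t. p t / (2 * pi) * (H t)\<^sup>2)"
      by (simp add: field_simps)
    ultimately show ?thesis
      by (simp only: integral_unique)
  qed
  finally have cost: "(\<integral>\<^sup>+z. ennreal (\<bar>fst z - snd z\<bar> powr 2)
      \<partial>distr ?\<mu> (borel \<Otimes>\<^sub>M borel) (\<lambda>x. (x, g x))) =
      ennreal (integral ?I (\<lambda>t. (H t)\<^sup>2) / (2 * pi))" .
  have "0 \<le> integral ?I (\<lambda>t. (H t)\<^sup>2)"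
    by (intro Henstock_Kurzweil_Integration.integral_nonneg integrable_continuous_interval
        continuous_intros cont) auto
  moreover have "distr ?\<mu> (borel \<Otimes>\<^sub>M borel) (\<lambda>x. (x, g x)) \<in> couplings ?\<mu> (distr ?\<mu> borel g)"
    by (rule graph_coupling) auto
  ultimately show ?thesis
    unfolding distr using cost by (intro wasserstein_2_le) auto
qed

section \<open>Lifts of a measure with continuous density\<close>

locale circle_density =
  fixes f :: "complex \<Rightarrow> real" and \<mu> :: "complex measure"
  assumes f: "continuous_on (sphere 0 1) f" "\<And>x. x \<in> sphere 0 1 \<Longrightarrow> 0 \<le> f x"
    and \<mu>_eq: "\<mu> = density circle_haar (\<lambda>x. ennreal (f x))"
    and \<mu>: "circle_prob \<mu>"
begin

definition p :: "real \<Rightarrow> real" where "p t = f (cis t)"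

lemma p_cont: "continuous_on UNIV p"
  unfolding p_def using f(1) by (rule continuous_on_cis_comp)

lemma p_nonneg: "0 \<le> p t"
  unfolding p_def using f(2) by simp

lemma cis_periodic: "cis (t + 2 * pi) = cis t"
  by (simp flip: cis_mult)

lemma p_periodic: "p (t + 2 * pi) = p t"
  by (simp add: p_def cis_periodic)

lemma moment_eq:
  assumes "0 \<le> u"
  shows "integral {u..u + 2 * pi} (\<lambda>t. of_real (p t) * cis (of_nat k * t)) = of_real (2 * pi) * moment \<mu> k"
proof -
  have cont: "continuous_on UNIV (\<lambda>t. complex_of_real (p t) * cis (of_nat k * t))"
    by (intro continuous_intros p_cont)
  have "moment \<mu> k = integral {0..2 * pi} (\<lambda>t. (f (cis t) / (2 * pi)) *\<^sub>R (cis t) ^ k)"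
    unfolding moment_def \<mu>_eq using f by (intro integral_density_circle_haar) (auto intro!: continuous_intros)
  also have "\<dots> = integral {0..2 * pi} (\<lambda>t. inverse (of_real (2 * pi)) * (of_real (p t) * cis (of_nat k * t)))"
    by (intro integral_cong) (simp add: p_def Complex.DeMoivre scaleR_conv_of_real field_simps)
  also have "\<dots> = inverse (of_real (2 * pi)) * integral {0..2 * pi} (\<lambda>t. of_real (p t) * cis (of_nat k * t))"
    by (rule Henstock_Kurzweil_Integration.integral_mult_right)
  also have "integral {0..2 * pi} (\<lambda>t. of_real (p t) * cis (of_nat k * t)) =
      integral {u..u + 2 * pi} (\<lambda>t. of_real (p t) * cis (of_nat k * t))"
  proof (rule integral_period_shift[symmetric, OF cont _ assms])
    show "complex_of_real (p (t + 2 * pi)) * cis (of_nat k * (t + 2 * pi)) = of_real (p t) * cis (of_nat k * t)" for t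
      unfolding p_periodic Complex.DeMoivre[symmetric] cis_periodic ..
  qed simp
  finally show ?thesis
    by (simp add: field_simps)
qed

lemma integral_p: "integral {0..2 * pi} p = 2 * pi"
proof -
  have "moment \<mu> 0 = 1"
    using prob_space.prob_space[OF circle_probD(3)[OF \<mu>]] by (simp add: moment_def)
  then have "integral {0..2 * pi} (\<lambda>t. complex_of_real (p t)) = of_real (2 * pi)"
    using moment_eq[of 0 0] by simp
  then show ?thesis
    using integral_complex_of_real_continuous[OF continuous_on_subset[OF p_cont subset_UNIV]]
    by (metis of_real_eq_iff)
qed

lemma lift_eq: "u \<in> {0..2 * pi} \<Longrightarrow>
    circle_lift_at u \<mu> = interval_density (\<lambda>t. p t / (2 * pi)) u (u + 2 * pi)"
  unfolding \<mu>_eq p_def using f by (rule circle_lift_at_density)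

lemma mean_lift:
  assumes "u \<in> {0..2 * pi}"
  shows "(\<integral>x. x \<partial>circle_lift_at u \<mu>) = integral {u..u + 2 * pi} (\<lambda>t. p t * t) / (2 * pi)"
proof -
  have "(\<integral>x. x \<partial>circle_lift_at u \<mu>) = integral {u..u + 2 * pi} (\<lambda>t. (p t / (2 * pi)) *\<^sub>R t)"
    unfolding lift_eq[OF assms] by (intro integral_interval_density continuous_intros p_cont) (auto simp: p_nonneg)
  also have "\<dots> = integral {u..u + 2 * pi} (\<lambda>t. (1 / (2 * pi)) * (p t * t))"
    by simp
  also have "\<dots> = (1 / (2 * pi)) * integral {u..u + 2 * pi} (\<lambda>t. p t * t)"
    by (rule Henstock_Kurzweil_Integration.integral_mult_right)
  finally show ?thesis by simp
qed

end

text \<open>With density 1 the same lemmas yield the lift of the Haar measure and its mean.\<close>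

interpretation haar: circle_density "\<lambda>_. 1" circle_haar
  by unfold_locales (auto simp: circle_prob_haar density_1)

lemma integral_ident_period: "integral {u..u + 2 * pi} (\<lambda>t::real. t) = 2 * pi * (u + pi)"
proof -
  have "((\<lambda>t::real. t) has_integral (((u + 2 * pi)\<^sup>2 - u\<^sup>2) / 2)) {u..u + 2 * pi}"
    by (rule ident_has_integral) simp
  then show ?thesis
    by (simp add: integral_unique power2_eq_square field_simps)
qed

lemma haar_lift_eq: "v \<in> {0..2 * pi} \<Longrightarrow>
    circle_lift_at v circle_haar = interval_density (\<lambda>_. 1 / (2 * pi)) v (v + 2 * pi)"
  using haar.lift_eq by (simp add: haar.p_def)

lemma mean_haar_lift: "v \<in> {0..2 * pi} \<Longrightarrow> (\<integral>x. x \<partial>circle_lift_at v circle_haar) = v + pi"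
  using haar.mean_lift[of v] by (simp add: haar.p_def integral_ident_period)

context circle_density
begin

lemma wasserstein_lift_le:
  assumes u: "u \<in> {0..2 * pi}" and v: "v \<in> {0..2 * pi}"
    and mean: "(\<integral>x. x \<partial>circle_lift_at u \<mu>) = (\<integral>x. x \<partial>circle_lift_at v circle_haar)"
    and E: "\<And>N. (\<Sum>k=1..N. (cmod (moment \<mu> k))\<^sup>2 / real k) \<le> E"
  shows "wasserstein 2 (circle_lift_at u \<mu>) (circle_lift_at v circle_haar) \<le> ennreal (sqrt (2 * E))"
proof -
  let ?I = "{u..u + 2 * pi}"
  obtain \<Phi> where \<Phi>: "\<And>x. (\<Phi> has_real_derivative p x) (at x)"
    using ex_antiderivative[OF p_cont] by blast
  \<comment> \<open>Normalised so that x + H x sends the left end u of one window to the left end v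
    of the other.\<close>
  define H where "H x = \<Phi> x - \<Phi> u - x + v" for x
  have H: "(H has_real_derivative p t - 1) (at t)" for t
    unfolding H_def by (auto intro!: derivative_eq_intros \<Phi>)
  have Hc: "continuous_on UNIV H"
    using H by (meson DERIV_isCont continuous_at_imp_continuous_on)
  have cont: "continuous_on ?I H" "continuous_on ?I p"
    using Hc p_cont continuous_on_subset by blast+
  have Hu: "H u = v - u"
    by (simp add: H_def)
  have \<Phi>_int: "(p has_integral (\<Phi> b - \<Phi> a)) {a..b}" if "a \<le> b" for a b
    using \<Phi> that by (intro fundamental_theorem_of_calculus)
      (auto simp: has_real_derivative_iff_has_vector_derivative[symmetric] has_field_derivative_at_within)
  have per: "H (t + 2 * pi) = H t" for t
  proof -
    \<comment> \<open>The increment over a period is constant as p is periodic, and its value at 0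
      is the integral of p minus 2 pi, which vanishes because \<mu> has mass 1.\<close>
    have "((\<lambda>t. H (t + 2 * pi) - H t) has_real_derivative 0) (at x)" for x
      using DERIV_diff[OF iffD1[OF DERIV_shift H[of "x + 2 * pi"]] H[of x]] by (simp add: p_periodic)
    then have "H (t + 2 * pi) - H t = H (0 + 2 * pi) - H 0"
      using DERIV_isconst_all[of "\<lambda>t. H (t + 2 * pi) - H t" t 0] by blast
    also have "\<dots> = 0"
      using \<Phi>_int[of 0 "2 * pi"] integral_p by (simp add: H_def integral_unique)
    finally show ?thesis by simp
  qed
  have mean0: "integral ?I H = 0"
  proof -
    have "integral ?I (\<lambda>t. p t * t) = 2 * pi * (v + pi)"
      using mean by (simp add: mean_lift[OF u] mean_haar_lift[OF v] field_simps)
    then have "((\<lambda>t. p t * t) has_integral 2 * pi * (v + pi)) ?I"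
      using cont by (metis integrable_continuous_interval integrable_integral continuous_on_mult continuous_on_id)
    moreover have "((\<lambda>t. t) has_integral 2 * pi * (u + pi)) ?I"
      using integral_ident_period[of u] by (metis integrable_continuous_interval integrable_integral continuous_on_id)
    ultimately have a: "((\<lambda>t. p t * t - t) has_integral 2 * pi * (v + pi) - 2 * pi * (u + pi)) ?I"
      by (rule has_integral_diff)
    \<comment> \<open>The integrand is the derivative of t H t. Its boundary term is 2 pi H u = 2 pi
      (v - u), and by equality of the means t (p - 1) has the same integral, leaving 0 for
      H.\<close>
    have b: "((\<lambda>t. H t + t * (p t - 1)) has_integral ((u + 2 * pi) * H (u + 2 * pi) - u * H u)) ?I"
    proof (rule fundamental_theorem_of_calculus)
      fix t
      have "((\<lambda>t. t * H t) has_real_derivative (H t + t * (p t - 1))) (at t)"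
        using DERIV_mult[OF DERIV_ident H[of t]] by (simp add: algebra_simps)
      then show "((\<lambda>t. t * H t) has_vector_derivative (H t + t * (p t - 1))) (at t within ?I)"
        by (simp add: has_real_derivative_iff_has_vector_derivative has_vector_derivative_at_within)
    qed simp
    have "((\<lambda>t. H t + t * (p t - 1) - (p t * t - t)) has_integral
        ((u + 2 * pi) * H (u + 2 * pi) - u * H u) - (2 * pi * (v + pi) - 2 * pi * (u + pi))) ?I"
      by (rule has_integral_diff[OF b a])
    moreover have "(\<lambda>t. H t + t * (p t - 1) - (p t * t - t)) = H"
      by (simp add: algebra_simps)
    moreover have "((u + 2 * pi) * H (u + 2 * pi) - u * H u) - (2 * pi * (v + pi) - 2 * pi * (u + pi)) = 0"
      unfolding per Hu by (simp add: algebra_simps)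
    ultimately show ?thesis
      by (simp only: integral_unique)
  qed
  define C where "C = integral ?I (\<lambda>t. (H t)\<^sup>2) / (2 * pi)"
  \<comment> \<open>The slack e absorbs the approximation error of \<open>Parseval_le\<close>, which
    enters squared and is therefore used with sqrt e. The cutoff N depends on e, but E bounds all
    partial sums.\<close>
  have "C \<le> 2 * E + e" if "0 < e" for e
  proof -
    from that have e: "0 < sqrt e" by simp
    obtain N where "integral ?I (\<lambda>t. (H t)\<^sup>2) \<le> 2 * pi * (sqrt e)\<^sup>2 +
        (\<Sum>k=1..N. 2 * (cmod (integral ?I (\<lambda>t. of_real (p t) * cis (of_nat k * t))))\<^sup>2 / (real k)\<^sup>2) / (2 * pi)"
      using variance_le_fourier[OF p_cont H per mean0 e] by blast
    also have "\<dots> = 2 * pi * (e + 2 * (\<Sum>k=1..N. (cmod (moment \<mu> k))\<^sup>2 / (real k)\<^sup>2))"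
    proof -
      have "u \<ge> 0"
        using u by simp
      then have "(\<Sum>k=1..N. 2 * (cmod (integral ?I (\<lambda>t. of_real (p t) * cis (of_nat k * t))))\<^sup>2 / (real k)\<^sup>2)
          = (\<Sum>k=1..N. (2 * pi)\<^sup>2 * (2 * ((cmod (moment \<mu> k))\<^sup>2 / (real k)\<^sup>2)))"
        by (intro sum.cong refl) (simp add: moment_eq norm_mult power_mult_distrib)
      also have "\<dots> = (2 * pi)\<^sup>2 * (2 * (\<Sum>k=1..N. (cmod (moment \<mu> k))\<^sup>2 / (real k)\<^sup>2))"
        by (simp only: sum_distrib_left)
      also have "\<dots> / (2 * pi) = 2 * pi * (2 * (\<Sum>k=1..N. (cmod (moment \<mu> k))\<^sup>2 / (real k)\<^sup>2))"
        by (simp add: power2_eq_square)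
      finally show ?thesis
        using that by (simp only: distrib_left real_sqrt_pow2 less_imp_le)
    qed
    \<comment> \<open>Transport weighs frequency k by 1 / k^2 and energy by 1 / k; they agree at k =
      1, and higher frequencies only help.\<close>
    also have "(\<Sum>k=1..N. (cmod (moment \<mu> k))\<^sup>2 / (real k)\<^sup>2) \<le> (\<Sum>k=1..N. (cmod (moment \<mu> k))\<^sup>2 / real k)"
      by (intro sum_mono divide_left_mono) (auto simp: power2_eq_square)
    also have "\<dots> \<le> E"
      by (rule E)
    finally show ?thesis
      by (simp add: C_def field_simps)
  qed
  then have "C \<le> 2 * E"
    by (rule field_le_epsilon)
  have "wasserstein 2 (circle_lift_at u \<mu>) (circle_lift_at v circle_haar) \<le> ennreal (sqrt C)"
    using wasserstein_2_uniform_le[OF p_cont p_nonneg H per, of u]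
    by (simp add: lift_eq[OF u] haar_lift_eq[OF v] Hu C_def)
  also have "\<dots> \<le> ennreal (sqrt (2 * E))"
    using \<open>C \<le> 2 * E\<close> by (intro ennreal_leI) simp
  finally show ?thesis .
qed

text \<open>The Haar lift at v has mean v + pi, which covers [pi, 3 pi]. Cutting \<mu> at 0 gives a
  mean m in [0, 2 pi], and cutting at 2 pi gives m + 2 pi, so one of these two cuts always lands in
  that range.\<close>

lemma ex_equal_means:
  obtains u v where "u \<in> {0..2 * pi}" "v \<in> {0..2 * pi}"
    "(\<integral>x. x \<partial>circle_lift_at u \<mu>) = (\<integral>x. x \<partial>circle_lift_at v circle_haar)"
proof -
  have int: "g integrable_on {a..b}" if "continuous_on UNIV g" for g :: "real \<Rightarrow> real" and a b
    using that by (intro integrable_continuous_interval continuous_on_subset[OF that]) auto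
  have ip: "integral {0..2 * pi} (\<lambda>t. p t * (2 * pi)) = 2 * pi * (2 * pi)"
    by (simp add: integral_p)
  define m where "m = integral {0..2 * pi} (\<lambda>t. p t * t) / (2 * pi)"
  have m0: "(\<integral>x. x \<partial>circle_lift_at 0 \<mu>) = m"
    using mean_lift[of 0] by (simp add: m_def)
  have "integral {2 * pi..2 * pi + 2 * pi} (\<lambda>t. p t * t) = integral {0..2 * pi} (\<lambda>t. p (t + 2 * pi) * (t + 2 * pi))"
    using integral_shift_real_ivl[of "2 * pi" "2 * pi" "2 * pi + 2 * pi" "\<lambda>t. p t * t"] by simp
  also have "\<dots> = integral {0..2 * pi} (\<lambda>t. p t * t + p t * (2 * pi))"
    by (simp add: p_periodic distrib_left)
  also have "\<dots> = integral {0..2 * pi} (\<lambda>t. p t * t) + integral {0..2 * pi} (\<lambda>t. p t * (2 * pi))"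
    by (intro Henstock_Kurzweil_Integration.integral_add int continuous_intros p_cont)
  also note ip
  finally have m1: "(\<integral>x. x \<partial>circle_lift_at (2 * pi) \<mu>) = m + 2 * pi"
    using mean_lift[of "2 * pi"] by (simp add: m_def field_simps)
  have "0 \<le> integral {0..2 * pi} (\<lambda>t. p t * t)"
    by (intro Henstock_Kurzweil_Integration.integral_nonneg int continuous_intros p_cont) (auto simp: p_nonneg)
  then have "0 \<le> m"
    by (simp add: m_def)
  have "integral {0..2 * pi} (\<lambda>t. p t * t) \<le> integral {0..2 * pi} (\<lambda>t. p t * (2 * pi))"
    by (intro integral_le int continuous_intros p_cont) (auto simp: p_nonneg intro!: mult_left_mono)
  then have "m \<le> 2 * pi"
    unfolding ip by (simp add: m_def divide_le_eq)
  show ?thesis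
  proof (cases "pi \<le> m")
    case True
    then show ?thesis
      using that[of 0 "m - pi"] m0 \<open>m \<le> 2 * pi\<close> mean_haar_lift[of "m - pi"] by simp
  next
    case False
    then show ?thesis
      using that[of "2 * pi" "m + pi"] m1 \<open>0 \<le> m\<close> mean_haar_lift[of "m + pi"] by simp
  qed
qed

lemma mod_wasserstein_le:
  assumes E: "\<And>N. (\<Sum>k=1..N. (cmod (moment \<mu> k))\<^sup>2 / real k) \<le> E"
  shows "mod_wasserstein 2 \<mu> circle_haar \<le> ennreal (sqrt (2 * E))"
proof -
  define S where "S = {wasserstein 2 (circle_lift_at u \<mu>) (circle_lift_at v circle_haar) | u v.
                u \<in> {0..2 * pi} \<and> v \<in> {0..2 * pi} \<and>
                (\<integral>x. x \<partial>circle_lift_at u \<mu>) = (\<integral>x. x \<partial>circle_lift_at v circle_haar)}"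
  have "S \<noteq> {}"
    unfolding S_def using ex_equal_means by blast
  moreover have "Sup S \<le> ennreal (sqrt (2 * E))"
    unfolding S_def using wasserstein_lift_le[OF _ _ _ E] by (intro Sup_least) auto
  ultimately show ?thesis
    unfolding mod_wasserstein_def S_def[symmetric] by simp
qed

end

theorem proposition6:
  shows "equilibrium_measure (\<lambda>_. 0) = circle_haar \<and>
    (\<exists>\<epsilon>::real. \<epsilon> > 0 \<and> transport_inequality ((1 + \<epsilon>) / 4) (\<lambda>_. 0))"
proof (intro conjI exI[of _ 1])
  show "equilibrium_measure (\<lambda>_. 0) = circle_haar"
    by (rule equilibrium_measure_0)
  show "transport_inequality ((1 + 1) / 4) (\<lambda>_. 0)"
    unfolding transport_inequality_def equilibrium_measure_0 log_energy_circle_haar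
  proof (intro allI impI)
    fix \<mu> assume "circle_prob \<mu> \<and> smooth_measure \<mu>"
    then obtain f where \<mu>: "circle_prob \<mu>" and f: "smooth_on_circle f" "\<forall>x\<in>sphere 0 1. 0 \<le> f x"
      "\<mu> = density circle_haar (\<lambda>x. ennreal (f x))"
      unfolding smooth_measure_def by blast
    interpret circle_density f \<mu>
      using \<mu> f smooth_on_circle_imp_continuous by unfold_locales auto
    have "ereal (1 / 2) * enn2ereal ((mod_wasserstein 2 \<mu> circle_haar)\<^sup>2) \<le> log_energy (\<lambda>_. 0) \<mu>"
    proof (cases "log_energy (\<lambda>_. 0) \<mu>")
      case (real E)
      then have E: "(\<Sum>k=1..N. (cmod (moment \<mu> k))\<^sup>2 / real k) \<le> E" for N
        using log_energy_ge_moments[OF \<mu>, of N] by simp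
      \<comment> \<open>The empty partial sum gives the sign that makes sqrt (2 E) square back to 2
        E.\<close>
      from E[of 0] have "0 \<le> E" by simp
      have "(mod_wasserstein 2 \<mu> circle_haar)\<^sup>2 \<le> (ennreal (sqrt (2 * E)))\<^sup>2"
        using E by (intro power_mono mod_wasserstein_le) auto
      also have "\<dots> = ennreal (2 * E)"
        using \<open>0 \<le> E\<close> by (simp add: ennreal_power)
      finally have "enn2ereal ((mod_wasserstein 2 \<mu> circle_haar)\<^sup>2) \<le> ereal (2 * E)"
        using \<open>0 \<le> E\<close> by (simp add: less_eq_ennreal.rep_eq)
      then have "ereal (1 / 2) * enn2ereal ((mod_wasserstein 2 \<mu> circle_haar)\<^sup>2) \<le> ereal (1 / 2) * ereal (2 * E)"
        by (intro ereal_mult_left_mono) auto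
      then show ?thesis
        using real by simp
    next
      case PInf
      then show ?thesis by simp
    next
      case MInf
      then show ?thesis
        using log_energy_nonneg[OF \<mu>] by simp
    qed
    then show "ereal ((1 + 1) / 4) * enn2ereal ((mod_wasserstein 2 \<mu> circle_haar)\<^sup>2)
        \<le> log_energy (\<lambda>_. 0) \<mu> - 0"
      by simp
  qed
qed simp

end
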